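(* Let $\Gamma$ be a finitely generated group admitting a non-elementary convergence action on a compact metrizable space. Let $d=d(\Gamma)$ be the minimal cardinality of a generating set of $\Gamma$. Then $$\kappa_{\le d+2}(\Gamma)=0 .$$
   Context: For a finitely generated group $\Gamma$ and a finite, not necessarily symmetric, generating set $S\subseteq\Gamma$, the Kazhdan constant is $$\kappa(\Gamma,S)=\inf_{\pi}\ \inf_{\xi\in\mathcal H,\ \|\xi\|=1}\ \max_{s\in S}\|\pi(s)\xi-\xi\|,$$ where $\pi:\Gamma\to\mathcal U(\mathcal H)$ ranges over all unitary representations of $\Gamma$ on (nonzero) Hilbert spaces $\mathcal H$ with $\mathcal H^\Gamma=\{0\}$. For an integer $r\ge d(\Gamma)$, $$\kappa_{\le r}(\Gamma)=\inf\{\kappa(\Gamma,S): S\subseteq\Gamma,\ \langle S\rangle=\Gamma,\ |S|\le r\}.$$ An action of a group by homeomorphisms on a compact metrizable space $X$ is a convergence action if every sequence of distinct group elements has a subsequence $(g_n)$ for which there are points $a,r\in X$ such that $g_n|_{X\setminus\{r\}}\to a$ locally uniformly, i.e. for every compact $C\subseteq X\setminus\{r\}$ and every neighborhood $U$ of $a$ one has $g_nC\subseteq U$ for all sufficiently large $n$. The limit set $\Lambda\subseteq X$ is the set of attracting points $a$ arising from such subsequences. The action is non-elementary if $\Lambda$ has more than two points. *)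

theory Defs
  imports
    "HOL-Analysis.Analysis"
    "HOL-Library.Infinite_Typeclass"
    "HOL-Algebra.Group_Action"
    "HOL-Algebra.Generated_Groups"
    "HOL-Algebra.Module"
    "HOL-Algebra.Algebraic_Closure_Type"
begin

section \<open>Generating sets\<close>

definition generating_set :: "('g, 'b) monoid_scheme \<Rightarrow> 'g set \<Rightarrow> bool" where
  "generating_set G S \<longleftrightarrow> S \<subseteq> carrier G \<and> generate G S = carrier G"

definition finitely_generated :: "('g, 'b) monoid_scheme \<Rightarrow> bool" where
  "finitely_generated G \<longleftrightarrow> (\<exists>S. finite S \<and> generating_set G S)"

definition min_generators :: "('g, 'b) monoid_scheme \<Rightarrow> nat" where
  "min_generators G = (LEAST n. \<exists>S. finite S \<and> generating_set G S \<and> card S = n)"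


section \<open>Complex Hilbert spaces and unitary representations\<close>

text \<open>
  Hilbert spaces are carrier-based, so that one can range over all of them (with carrier inside
  a given type) in a single definition. The fields \<open>mult\<close> and \<open>one\<close> inherited from the
  \<open>module\<close> record play no role. The inner product is linear in its first argument.
\<close>

record 'h hilbert = "(complex, 'h) module" +
  hinner :: "'h \<Rightarrow> 'h \<Rightarrow> complex"

definition hnorm :: "('h, 'm) hilbert_scheme \<Rightarrow> 'h \<Rightarrow> real" where
  "hnorm H x = sqrt (Re (hinner H x x))"

locale complex_hilbert_space =
  Module.module "ring_of_type_algebra :: complex ring" H
  for H :: "('h, 'm) hilbert_scheme" (structure) +
  assumes hinner_add_left:
      "\<lbrakk>x \<in> carrier H; y \<in> carrier H; z \<in> carrier H\<rbrakk>
        \<Longrightarrow> hinner H (x \<oplus> y) z = hinner H x z + hinner H y z"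
    and hinner_smult_left:
      "\<lbrakk>x \<in> carrier H; y \<in> carrier H\<rbrakk> \<Longrightarrow> hinner H (c \<odot> x) y = c * hinner H x y"
    and hinner_commute:
      "\<lbrakk>x \<in> carrier H; y \<in> carrier H\<rbrakk> \<Longrightarrow> hinner H x y = cnj (hinner H y x)"
    and hinner_pos:
      "\<lbrakk>x \<in> carrier H; x \<noteq> \<zero>\<rbrakk> \<Longrightarrow> 0 < Re (hinner H x x)"
    and complete:
      "\<lbrakk>\<And>n::nat. u n \<in> carrier H;
        \<And>e. 0 < e \<Longrightarrow> \<exists>N. \<forall>m\<ge>N. \<forall>n\<ge>N. hnorm H (u m \<ominus> u n) < e\<rbrakk>
        \<Longrightarrow> \<exists>l\<in>carrier H. (\<lambda>n. hnorm H (u n \<ominus> l)) \<longlonglongrightarrow> 0"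

definition unitaries :: "('h, 'm) hilbert_scheme \<Rightarrow> ('h \<Rightarrow> 'h) set" where
  "unitaries H = {U \<in> Bij (carrier H).
     (\<forall>x\<in>carrier H. \<forall>y\<in>carrier H. U (x \<oplus>\<^bsub>H\<^esub> y) = U x \<oplus>\<^bsub>H\<^esub> U y) \<and>
     (\<forall>c. \<forall>x\<in>carrier H. U (c \<odot>\<^bsub>H\<^esub> x) = c \<odot>\<^bsub>H\<^esub> U x) \<and>
     (\<forall>x\<in>carrier H. \<forall>y\<in>carrier H. hinner H (U x) (U y) = hinner H x y)}"

definition unitary_group :: "('h, 'm) hilbert_scheme \<Rightarrow> ('h \<Rightarrow> 'h) monoid" where
  "unitary_group H = BijGroup (carrier H) \<lparr>carrier := unitaries H\<rparr>"

definition unitary_rep ::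
  "('g, 'b) monoid_scheme \<Rightarrow> ('h, 'm) hilbert_scheme \<Rightarrow> ('g \<Rightarrow> 'h \<Rightarrow> 'h) \<Rightarrow> bool" where
  "unitary_rep G H \<pi> \<longleftrightarrow> complex_hilbert_space H \<and> \<pi> \<in> hom G (unitary_group H)"

definition fixed_vectors ::
  "('g, 'b) monoid_scheme \<Rightarrow> ('h, 'm) hilbert_scheme \<Rightarrow> ('g \<Rightarrow> 'h \<Rightarrow> 'h) \<Rightarrow> 'h set" where
  "fixed_vectors G H \<pi> = {x \<in> carrier H. \<forall>g\<in>carrier G. \<pi> g x = x}"


section \<open>Kazhdan constants\<close>

text \<open>
  HOL cannot quantify over types inside a definition, so the type argument \<open>'h\<close> serves as the
  universe: the Hilbert spaces considered are those whose underlying set is a set of elements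
  of \<open>'h\<close>, with arbitrary operations. For an infinite type \<open>'i\<close> the type
  \<open>'i \<Rightarrow> complex\<close> contains \<open>\<ell>\<^sup>2(I)\<close> for every \<open>I \<subseteq> 'i\<close>, hence an isometric copy of every Hilbert
  space of Hilbert dimension at most the cardinality of \<open>'i\<close>; by varying \<open>'i\<close> one reaches all
  Hilbert spaces. For a countable group every infinite \<open>'i\<close> gives the same constant, since a
  unit vector may be studied in the (separable) cyclic subrepresentation it generates.

  Values are in \<open>ennreal\<close>, so that an infimum over the empty set is \<open>\<infinity>\<close>.
\<close>

definition kazhdan_const ::
  "'h itself \<Rightarrow> ('g, 'b) monoid_scheme \<Rightarrow> 'g set \<Rightarrow> ennreal" where
  "kazhdan_const (_ :: 'h itself) G S =
     (INF (H, \<pi>) \<in> {(H :: 'h hilbert, \<pi>).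
          unitary_rep G H \<pi> \<and> carrier H \<noteq> {\<zero>\<^bsub>H\<^esub>} \<and> fixed_vectors G H \<pi> = {\<zero>\<^bsub>H\<^esub>}}.
      INF \<xi> \<in> {\<xi> \<in> carrier H. hnorm H \<xi> = 1}.
      MAX s\<in>S. ennreal (hnorm H (\<pi> s \<xi> \<ominus>\<^bsub>H\<^esub> \<xi>)))"

definition kazhdan_const_le ::
  "'h itself \<Rightarrow> ('g, 'b) monoid_scheme \<Rightarrow> nat \<Rightarrow> ennreal" where
  "kazhdan_const_le U G r =
     (INF S \<in> {S. finite S \<and> generating_set G S \<and> card S \<le> r}. kazhdan_const U G S)"


section \<open>Convergence actions\<close>

definition acts_by_homeomorphisms ::
  "('g, 'b) monoid_scheme \<Rightarrow> 'x topology \<Rightarrow> ('g \<Rightarrow> 'x \<Rightarrow> 'x) \<Rightarrow> bool" where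
  "acts_by_homeomorphisms G T \<phi> \<longleftrightarrow>
     group_action G (topspace T) \<phi> \<and> (\<forall>g\<in>carrier G. homeomorphic_map T T (\<phi> g))"

text \<open>\<open>g\<^sub>n\<close> restricted to \<open>T - {r}\<close> converges to \<open>a\<close> locally uniformly.\<close>

definition collapses_to ::
  "'x topology \<Rightarrow> ('g \<Rightarrow> 'x \<Rightarrow> 'x) \<Rightarrow> (nat \<Rightarrow> 'g) \<Rightarrow> 'x \<Rightarrow> 'x \<Rightarrow> bool" where
  "collapses_to T \<phi> g r a \<longleftrightarrow> r \<in> topspace T \<and> a \<in> topspace T \<and>
     (\<forall>C U. compactin T C \<longrightarrow> r \<notin> C \<longrightarrow> openin T U \<longrightarrow> a \<in> U \<longrightarrow>
        (\<forall>\<^sub>F n in sequentially. \<phi> (g n) ` C \<subseteq> U))"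

definition distinct_seq :: "('g, 'b) monoid_scheme \<Rightarrow> (nat \<Rightarrow> 'g) \<Rightarrow> bool" where
  "distinct_seq G g \<longleftrightarrow> inj g \<and> range g \<subseteq> carrier G"

definition convergence_action ::
  "('g, 'b) monoid_scheme \<Rightarrow> 'x topology \<Rightarrow> ('g \<Rightarrow> 'x \<Rightarrow> 'x) \<Rightarrow> bool" where
  "convergence_action G T \<phi> \<longleftrightarrow> acts_by_homeomorphisms G T \<phi> \<and>
     (\<forall>g. distinct_seq G g \<longrightarrow>
        (\<exists>\<sigma> r a. strict_mono (\<sigma> :: nat \<Rightarrow> nat) \<and> collapses_to T \<phi> (g \<circ> \<sigma>) r a))"

text \<open>A subsequence of a sequence of distinct elements is again such a sequence.\<close>

definition limit_set ::
  "('g, 'b) monoid_scheme \<Rightarrow> 'x topology \<Rightarrow> ('g \<Rightarrow> 'x \<Rightarrow> 'x) \<Rightarrow> 'x set" where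
  "limit_set G T \<phi> = {a. \<exists>g r. distinct_seq G g \<and> collapses_to T \<phi> g r a}"

definition non_elementary ::
  "('g, 'b) monoid_scheme \<Rightarrow> 'x topology \<Rightarrow> ('g \<Rightarrow> 'x \<Rightarrow> 'x) \<Rightarrow> bool" where
  "non_elementary G T \<phi> \<longleftrightarrow> infinite (limit_set G T \<phi>) \<or> card (limit_set G T \<phi>) > 2"

end

theory Submission
  imports Defs
begin

text \<open>
  Let \<open>s\<^sub>1, \<dots>, s\<^sub>d\<close> generate \<open>G\<close>. Pick \<open>t\<close> of infinite order; it fixes a point \<open>p\<close>. Pick \<open>g\<close> far out in a
  collapsing sequence whose attracting point \<open>y\<close> and repelling point \<open>z\<close> are generic with respect
  to \<open>t\<close> and the \<open>s\<^sub>i\<close>, and put \<open>b\<^sub>i = g s\<^sub>i g\<close> and \<open>b\<^sub>0 = g\<close>. All of these attract to \<open>y\<close> and repel from \<open>z\<close>,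
  so the conjugates \<open>t\<^sup>m b\<^sub>i t\<^sup>-\<^sup>m\<close> for \<open>m = i N + k\<close>, \<open>k < N\<close>, play ping-pong near the distinct points
  \<open>t\<^sup>m y\<close>, \<open>t\<^sup>m z\<close>. Nontrivial elements of the group \<open>H\<close> that they generate move \<open>p\<close>, hence \<open>H\<close>
  contains no nontrivial power of \<open>t\<close>.

  The \<open>d + 2\<close> elements \<open>t\<close> and \<open>h\<^sub>i = t\<^sup>i\<^sup>N b\<^sub>i t\<^sup>-\<^sup>i\<^sup>N\<close> generate \<open>G\<close>. In \<open>\<ell>\<^sup>2(G/H)\<close>, which has no invariant
  vectors because \<open>H\<close> has infinite index, consider the normalised indicator of the \<open>N\<close> cosets
  \<open>t\<^sup>-\<^sup>k H\<close>, \<open>k < N\<close>. Each \<open>h\<^sub>i\<close> fixes it, since \<open>t\<^sup>k h\<^sub>i t\<^sup>-\<^sup>k\<close> lies in \<open>H\<close>, and \<open>t\<close> moves it by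
  \<open>(2/N)\<^sup>1\<^sup>/\<^sup>2\<close>.
\<close>

section \<open>The Hilbert space of square-summable functions\<close>

text \<open>Vectors are functions on the whole type that vanish off \<open>A\<close>, so equality of
  vectors is equality of functions, and a single type hosts the space of every index set inside
  \<open>'i\<close>.\<close>

definition ell2 :: "'i set \<Rightarrow> ('i \<Rightarrow> complex) hilbert" where
  "ell2 A = \<lparr>carrier = {f. (\<forall>i. i \<notin> A \<longrightarrow> f i = 0) \<and> (\<lambda>i. (cmod (f i))\<^sup>2) summable_on A},
     mult = (\<lambda>f g. f), one = (\<lambda>i. 0), zero = (\<lambda>i. 0), add = (\<lambda>f g i. f i + g i),
     smult = (\<lambda>c f i. c * f i), hinner = (\<lambda>f g. \<Sum>\<^sub>\<infinity>i\<in>A. f i * cnj (g i))\<rparr>"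

lemma ell2_simps [simp]:
  "zero (ell2 A) = (\<lambda>i. 0)"
  "add (ell2 A) f g = (\<lambda>i. f i + g i)"
  "smult (ell2 A) c f = (\<lambda>i. c * f i)"
  "hinner (ell2 A) f g = (\<Sum>\<^sub>\<infinity>i\<in>A. f i * cnj (g i))"
  by (simp_all add: ell2_def)

lemma carrier_ell2:
  "f \<in> carrier (ell2 A) \<longleftrightarrow> (\<forall>i. i \<notin> A \<longrightarrow> f i = 0) \<and> (\<lambda>i. (cmod (f i))\<^sup>2) summable_on A"
  by (simp add: ell2_def)

lemma ell2_summable_add:
  assumes "(\<lambda>i. (cmod (f i))\<^sup>2) summable_on A" "(\<lambda>i. (cmod (g i))\<^sup>2) summable_on A"
  shows "(\<lambda>i. (cmod (f i + g i))\<^sup>2) summable_on A"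
proof -
  have "(\<lambda>i. 2 * (cmod (f i))\<^sup>2 + 2 * (cmod (g i))\<^sup>2) summable_on A"
    using assms by (intro summable_on_add summable_on_cmult_right)
  then have s: "(\<lambda>i. norm (2 * (cmod (f i))\<^sup>2 + 2 * (cmod (g i))\<^sup>2)) summable_on A" by simp
  have "(cmod (f i + g i))\<^sup>2 \<le> 2 * (cmod (f i))\<^sup>2 + 2 * (cmod (g i))\<^sup>2" for i
  proof -
    have "(cmod (f i + g i))\<^sup>2 \<le> (cmod (f i) + cmod (g i))\<^sup>2"
      by (intro power_mono norm_triangle_ineq norm_ge_zero)
    also have "\<dots> \<le> 2 * (cmod (f i))\<^sup>2 + 2 * (cmod (g i))\<^sup>2"
      using zero_le_power2[of "cmod (f i) - cmod (g i)"] by (simp add: power2_eq_square algebra_simps)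
    finally show ?thesis .
  qed
  then have "(\<lambda>i. norm ((cmod (f i + g i))\<^sup>2)) summable_on A"
    by (intro Infinite_Sum.abs_summable_on_comparison_test[OF s]) simp
  then show ?thesis by simp
qed

lemma ell2_summable_inner:
  assumes "(\<lambda>i. (cmod (f i))\<^sup>2) summable_on A" "(\<lambda>i. (cmod (g i))\<^sup>2) summable_on A"
  shows "(\<lambda>i. f i * cnj (g i)) summable_on A"
proof -
  have "(\<lambda>i. (cmod (f i))\<^sup>2 + (cmod (g i))\<^sup>2) summable_on A"
    using assms by (intro summable_on_add)
  then have s: "(\<lambda>i. norm ((cmod (f i))\<^sup>2 + (cmod (g i))\<^sup>2)) summable_on A" by simp
  have "cmod (f i * cnj (g i)) \<le> norm ((cmod (f i))\<^sup>2 + (cmod (g i))\<^sup>2)" for i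
  proof -
    have "0 \<le> cmod (f i) * cmod (g i)" by simp
    moreover have "2 * (cmod (f i) * cmod (g i)) \<le> (cmod (f i))\<^sup>2 + (cmod (g i))\<^sup>2"
      using zero_le_power2[of "cmod (f i) - cmod (g i)"] by (simp add: power2_diff)
    ultimately have "cmod (f i) * cmod (g i) \<le> (cmod (f i))\<^sup>2 + (cmod (g i))\<^sup>2" by linarith
    then show ?thesis by (simp add: norm_mult)
  qed
  then have "(\<lambda>i. norm (f i * cnj (g i))) summable_on A"
    by (intro Infinite_Sum.abs_summable_on_comparison_test[OF s])
  then show ?thesis by (rule abs_summable_summable)
qed

text \<open>Summability passes through \<open>of_real\<close> in both directions. If
  \<open>f\<close> is not square-summable, both infinite sums take the default value 0, so the
  identity holds for every \<open>f\<close>.\<close>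

lemma ell2_inner_self: "hinner (ell2 A) f f = of_real (\<Sum>\<^sub>\<infinity>i\<in>A. (cmod (f i))\<^sup>2)"
proof -
  have "hinner (ell2 A) f f = (\<Sum>\<^sub>\<infinity>i\<in>A. of_real ((cmod (f i))\<^sup>2))"
    by (simp add: complex_norm_square flip: of_real_power)
  also have "\<dots> = of_real (\<Sum>\<^sub>\<infinity>i\<in>A. (cmod (f i))\<^sup>2)"
    by (rule infsum_bounded_linear_strong[where h = of_real])
      (auto simp: bounded_linear_of_real dest: summable_on_Re summable_on_of_real[where 'a = complex]
        simp del: of_real_power)
  finally show ?thesis .
qed

lemma hnorm_ell2: "hnorm (ell2 A) f = sqrt (\<Sum>\<^sub>\<infinity>i\<in>A. (cmod (f i))\<^sup>2)"
  unfolding hnorm_def ell2_inner_self by simp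

lemma ell2_smult_closed: "f \<in> carrier (ell2 A) \<Longrightarrow> (\<lambda>i. c * f i) \<in> carrier (ell2 A)"
  by (auto simp: carrier_ell2 norm_mult power_mult_distrib intro: summable_on_cmult_right)

lemma ell2_uminus_closed: "f \<in> carrier (ell2 A) \<Longrightarrow> (\<lambda>i. - f i) \<in> carrier (ell2 A)"
  by (auto simp: carrier_ell2)

lemma ell2_add_closed:
  "f \<in> carrier (ell2 A) \<Longrightarrow> g \<in> carrier (ell2 A) \<Longrightarrow> (\<lambda>i. f i + g i) \<in> carrier (ell2 A)"
  by (auto simp: carrier_ell2 intro: ell2_summable_add)

lemma abelian_group_ell2: "abelian_group (ell2 A)"
proof (rule abelian_groupI)
  fix f assume "f \<in> carrier (ell2 A)"
  then show "\<exists>g\<in>carrier (ell2 A). g \<oplus>\<^bsub>ell2 A\<^esub> f = \<zero>\<^bsub>ell2 A\<^esub>"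
    using ell2_uminus_closed[of f A] by (intro bexI[of _ "\<lambda>i. - f i"]) auto
qed (auto simp: ell2_add_closed add.assoc add.commute carrier_ell2[of "\<lambda>i. 0"])

lemma module_ell2: "Module.module (ring_of_type_algebra :: complex ring) (ell2 A)"
  by (rule moduleI)
    (auto simp: abelian_group_ell2 ell2_smult_closed ring_of_type_algebra_def algebra_simps
      intro: cring_from_type_algebra[unfolded ring_of_type_algebra_def])

lemma ell2_minus:
  assumes "f \<in> carrier (ell2 A)" "g \<in> carrier (ell2 A)"
  shows "f \<ominus>\<^bsub>ell2 A\<^esub> g = (\<lambda>i. f i - g i)"
proof -
  have "\<ominus>\<^bsub>ell2 A\<^esub> g = (\<lambda>i. - g i)"
    using assms ell2_uminus_closed by (intro abelian_group.minus_equality[OF abelian_group_ell2]) auto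
  then show ?thesis by (simp add: a_minus_def)
qed

lemma ell2_minus_closed:
  "f \<in> carrier (ell2 A) \<Longrightarrow> g \<in> carrier (ell2 A) \<Longrightarrow> (\<lambda>i. f i - g i) \<in> carrier (ell2 A)"
  using ell2_add_closed[of f A "\<lambda>i. - g i"] ell2_uminus_closed[of g A] by simp

section \<open>Norms through finite partial sums, and completeness\<close>

lemma hnorm_ell2_bound:
  assumes "f \<in> carrier (ell2 A)" "finite F" "F \<subseteq> A"
  shows "(\<Sum>i\<in>F. (cmod (f i))\<^sup>2) \<le> (hnorm (ell2 A) f)\<^sup>2"
  using finite_sum_le_infsum[of "\<lambda>i. (cmod (f i))\<^sup>2" A F] assms
  by (simp add: hnorm_ell2 carrier_ell2 infsum_nonneg)

lemma hnorm_ell2_finite_support: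
  assumes "finite F" "F \<subseteq> A" "\<And>i. i \<notin> F \<Longrightarrow> f i = 0"
  shows "f \<in> carrier (ell2 A)" "hnorm (ell2 A) f = sqrt (\<Sum>i\<in>F. (cmod (f i))\<^sup>2)"
proof -
  have "(\<lambda>i. (cmod (f i))\<^sup>2) summable_on A \<longleftrightarrow> (\<lambda>i. (cmod (f i))\<^sup>2) summable_on F"
    using assms by (intro summable_on_cong_neutral) auto
  then show "f \<in> carrier (ell2 A)" using assms by (auto simp: carrier_ell2)
  have "(\<Sum>\<^sub>\<infinity>i\<in>A. (cmod (f i))\<^sup>2) = (\<Sum>\<^sub>\<infinity>i\<in>F. (cmod (f i))\<^sup>2)"
    using assms by (intro infsum_cong_neutral) auto
  then show "hnorm (ell2 A) f = sqrt (\<Sum>i\<in>F. (cmod (f i))\<^sup>2)" using assms by (simp add: hnorm_ell2)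
qed

text \<open>Nonnegative terms with bounded finite partial sums are summable. Bounds on finite sums
  survive pointwise limits, which is how completeness uses this.\<close>

lemma hnorm_ell2_le:
  assumes "\<And>F. finite F \<Longrightarrow> F \<subseteq> A \<Longrightarrow> (\<Sum>i\<in>F. (cmod (f i))\<^sup>2) \<le> e\<^sup>2" "0 \<le> e" "\<And>i. i \<notin> A \<Longrightarrow> f i = 0"
  shows "f \<in> carrier (ell2 A)" "hnorm (ell2 A) f \<le> e"
proof -
  have s: "(\<lambda>i. (cmod (f i))\<^sup>2) summable_on A"
    by (rule nonneg_bounded_partial_sums_imp_summable_on[where C = "e\<^sup>2"])
      (auto intro!: eventually_finite_subsets_at_top_weakI assms)
  then show "f \<in> carrier (ell2 A)" using assms(3) by (simp add: carrier_ell2)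
  have "(\<Sum>\<^sub>\<infinity>i\<in>A. (cmod (f i))\<^sup>2) \<le> e\<^sup>2"
    using infsum_le_finite_sums[OF s] assms(1) by blast
  then show "hnorm (ell2 A) f \<le> e" unfolding hnorm_ell2 using assms(2) real_le_lsqrt by blast
qed

lemma ell2_complete:
  fixes u :: "nat \<Rightarrow> 'i \<Rightarrow> complex"
  assumes u: "\<And>n. u n \<in> carrier (ell2 A)"
    and cauchy: "\<And>e. 0 < e \<Longrightarrow> \<exists>N. \<forall>m\<ge>N. \<forall>n\<ge>N. hnorm (ell2 A) (u m \<ominus>\<^bsub>ell2 A\<^esub> u n) < e"
  shows "\<exists>l\<in>carrier (ell2 A). (\<lambda>n. hnorm (ell2 A) (u n \<ominus>\<^bsub>ell2 A\<^esub> l)) \<longlonglongrightarrow> 0"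
proof -
  have cauchy': "\<exists>N. \<forall>m\<ge>N. \<forall>n\<ge>N. hnorm (ell2 A) (\<lambda>i. u m i - u n i) < e" if "0 < e" for e
    using cauchy[OF that] u by (simp add: ell2_minus)
  have "\<exists>l. (\<lambda>n. u n i) \<longlonglongrightarrow> l" for i
  proof (cases "i \<in> A")
    case True
    \<comment> \<open>Evaluation at \<open>i\<close> is dominated by the norm: take the partial sum
      over \<open>{i}\<close>.\<close>
    have "Cauchy (\<lambda>n. u n i)"
    proof (rule CauchyI)
      fix e :: real assume "0 < e"
      then obtain N where N: "\<forall>m\<ge>N. \<forall>n\<ge>N. hnorm (ell2 A) (\<lambda>i. u m i - u n i) < e" using cauchy' by blast
      have "cmod (u m i - u n i) < e" if "m \<ge> N" "n \<ge> N" for m n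
      proof -
        have "(cmod (u m i - u n i))\<^sup>2 \<le> (hnorm (ell2 A) (\<lambda>i. u m i - u n i))\<^sup>2"
          using hnorm_ell2_bound[OF ell2_minus_closed[OF u u], of "{i}" m n] True by simp
        then have "cmod (u m i - u n i) \<le> hnorm (ell2 A) (\<lambda>i. u m i - u n i)"
          by (rule power2_le_imp_le) (simp add: hnorm_ell2 infsum_nonneg)
        then show ?thesis using N that by fastforce
      qed
      then show "\<exists>M. \<forall>m\<ge>M. \<forall>n\<ge>M. cmod (u m i - u n i) < e" by blast
    qed
    then show ?thesis using Cauchy_convergent_iff convergent_def by blast
  next
    case False
    then have "u n i = 0" for n using u[of n] by (simp add: carrier_ell2)
    then show ?thesis by auto
  qed
  then obtain l where l: "\<And>i. (\<lambda>n. u n i) \<longlonglongrightarrow> l i" by metis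
  have l0: "l i = 0" if "i \<notin> A" for i
  proof -
    have "u n i = 0" for n using u[of n] that by (simp add: carrier_ell2)
    then have "(\<lambda>n. 0) \<longlonglongrightarrow> l i" using l[of i] by simp
    then show ?thesis by (simp add: LIMSEQ_const_iff)
  qed
  have close: "\<exists>N. \<forall>m\<ge>N. (\<lambda>i. u m i - l i) \<in> carrier (ell2 A) \<and> hnorm (ell2 A) (\<lambda>i. u m i - l i) \<le> e"
    if "0 < e" for e
  proof -
    obtain N where N: "\<forall>m\<ge>N. \<forall>n\<ge>N. hnorm (ell2 A) (\<lambda>i. u m i - u n i) < e" using cauchy' \<open>0 < e\<close> by blast
    \<comment> \<open>Fatou-type argument: keep \<open>m\<close> and the finite set \<open>F\<close>
      fixed and let \<open>n\<close> tend to infinity.\<close>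
    have "(\<Sum>i\<in>F. (cmod (u m i - l i))\<^sup>2) \<le> e\<^sup>2" if m: "m \<ge> N" and F: "finite F" "F \<subseteq> A" for m F
    proof (rule LIMSEQ_le_const2)
      show "(\<lambda>n. \<Sum>i\<in>F. (cmod (u m i - u n i))\<^sup>2) \<longlonglongrightarrow> (\<Sum>i\<in>F. (cmod (u m i - l i))\<^sup>2)"
        by (intro tendsto_intros l)
      have "(\<Sum>i\<in>F. (cmod (u m i - u n i))\<^sup>2) \<le> e\<^sup>2" if "n \<ge> N" for n
      proof -
        have "(\<Sum>i\<in>F. (cmod (u m i - u n i))\<^sup>2) \<le> (hnorm (ell2 A) (\<lambda>i. u m i - u n i))\<^sup>2"
          using hnorm_ell2_bound[OF ell2_minus_closed[OF u u] F] by blast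
        also have "\<dots> \<le> e\<^sup>2"
          using N m that by (intro power_mono) (auto simp: hnorm_ell2 infsum_nonneg less_imp_le)
        finally show ?thesis .
      qed
      then show "\<exists>N. \<forall>n\<ge>N. (\<Sum>i\<in>F. (cmod (u m i - u n i))\<^sup>2) \<le> e\<^sup>2" by blast
    qed
    then have "(\<lambda>i. u m i - l i) \<in> carrier (ell2 A) \<and> hnorm (ell2 A) (\<lambda>i. u m i - l i) \<le> e" if "m \<ge> N" for m
      using hnorm_ell2_le[of A "\<lambda>i. u m i - l i" e] \<open>0 < e\<close> that l0 u[of m] by (simp add: carrier_ell2)
    then show ?thesis by blast
  qed
  obtain N where "(\<lambda>i. u N i - l i) \<in> carrier (ell2 A)" using close[of 1] by auto
  \<comment> \<open>Write \<open>l\<close> as \<open>u N - (u N - l)\<close>, a difference of two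
    vectors of the space.\<close>
  then have lc: "l \<in> carrier (ell2 A)" using ell2_minus_closed[OF u[of N]] by fastforce
  have "(\<lambda>n. hnorm (ell2 A) (\<lambda>i. u n i - l i)) \<longlonglongrightarrow> 0"
  proof (rule LIMSEQ_I)
    fix e :: real assume "0 < e"
    then obtain N where "\<forall>m\<ge>N. hnorm (ell2 A) (\<lambda>i. u m i - l i) \<le> e / 2" using close[of "e/2"] by auto
    then have "\<forall>m\<ge>N. norm (hnorm (ell2 A) (\<lambda>i. u m i - l i) - 0) < e"
      using \<open>0 < e\<close> by (fastforce simp: hnorm_ell2 infsum_nonneg)
    then show "\<exists>N. \<forall>n\<ge>N. norm (hnorm (ell2 A) (\<lambda>i. u n i - l i) - 0) < e" by blast
  qed
  then show ?thesis using lc u by (intro bexI[of _ l]) (simp_all add: ell2_minus)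
qed

lemma complex_hilbert_space_ell2: "complex_hilbert_space (ell2 A)"
proof (intro complex_hilbert_space.intro module_ell2 complex_hilbert_space_axioms.intro)
  fix f g h assume "f \<in> carrier (ell2 A)" "g \<in> carrier (ell2 A)" "h \<in> carrier (ell2 A)"
  then show "hinner (ell2 A) (f \<oplus>\<^bsub>ell2 A\<^esub> g) h = hinner (ell2 A) f h + hinner (ell2 A) g h"
    by (simp add: carrier_ell2 distrib_right infsum_add ell2_summable_inner)
next
  fix f g c
  show "hinner (ell2 A) (c \<odot>\<^bsub>ell2 A\<^esub> f) g = c * hinner (ell2 A) f g"
    by (simp add: mult.assoc infsum_cmult_right')
next
  fix f g
  show "hinner (ell2 A) f g = cnj (hinner (ell2 A) g f)"
    by (simp add: mult.commute flip: infsum_cnj)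
next
  fix f assume f: "f \<in> carrier (ell2 A)" "f \<noteq> \<zero>\<^bsub>ell2 A\<^esub>"
  then obtain i where i: "f i \<noteq> 0" "i \<in> A" by (auto simp: carrier_ell2)
  have "0 < (cmod (f i))\<^sup>2" using i by simp
  also have "\<dots> \<le> (\<Sum>\<^sub>\<infinity>i\<in>A. (cmod (f i))\<^sup>2)"
    using finite_sum_le_infsum[of "\<lambda>i. (cmod (f i))\<^sup>2" A "{i}"] f i by (simp add: carrier_ell2)
  finally show "0 < Re (hinner (ell2 A) f f)" unfolding ell2_inner_self by simp
qed (rule ell2_complete)


section \<open>Permutation representations and almost invariant sets\<close>

text \<open>The inverse makes this a left action on functions. The restriction to the carrier is
  what membership in \<open>Bij\<close> demands.\<close>

definition perm_rep ::
  "('g, 'b) monoid_scheme \<Rightarrow> 'i set \<Rightarrow> ('g \<Rightarrow> 'i \<Rightarrow> 'i) \<Rightarrow> 'g \<Rightarrow> ('i \<Rightarrow> complex) \<Rightarrow> 'i \<Rightarrow> complex" where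
  "perm_rep G A \<psi> g = (\<lambda>f\<in>carrier (ell2 A). \<lambda>i. if i \<in> A then f (\<psi> (inv\<^bsub>G\<^esub> g) i) else 0)"

context group_action
begin

interpretation group G
  using group_hom group_hom.axioms(1) by blast

lemma perm_rep_apply:
  "f \<in> carrier (ell2 E) \<Longrightarrow> perm_rep G E \<phi> g f = (\<lambda>i. if i \<in> E then f (\<phi> (inv g) i) else 0)"
  by (simp add: perm_rep_def)

lemma act_bij_betw: "g \<in> carrier G \<Longrightarrow> bij_betw (\<phi> g) E E"
  using inj_prop surj_prop by (simp add: bij_betw_def)

lemma perm_rep_closed:
  assumes "g \<in> carrier G" "f \<in> carrier (ell2 E)"
  shows "perm_rep G E \<phi> g f \<in> carrier (ell2 E)"
proof -
  have "(\<lambda>i. (cmod (f (\<phi> (inv g) i)))\<^sup>2) summable_on E"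
    using summable_on_reindex_bij_betw[OF act_bij_betw[of "inv g"], of "\<lambda>i. (cmod (f i))\<^sup>2"] assms
    by (simp add: carrier_ell2)
  moreover have "(\<lambda>i. (cmod (if i \<in> E then f (\<phi> (inv g) i) else 0))\<^sup>2) summable_on E
      \<longleftrightarrow> (\<lambda>i. (cmod (f (\<phi> (inv g) i)))\<^sup>2) summable_on E"
    by (rule summable_on_cong) simp
  ultimately show ?thesis using assms by (simp add: perm_rep_apply carrier_ell2)
qed

lemma perm_rep_mult:
  assumes "g \<in> carrier G" "h \<in> carrier G" "f \<in> carrier (ell2 E)"
  shows "perm_rep G E \<phi> (g \<otimes> h) f = perm_rep G E \<phi> g (perm_rep G E \<phi> h f)"
  using assms perm_rep_closed[OF assms(2,3)] element_image[of "inv g"]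
  by (auto simp: perm_rep_apply inv_mult_group composition_rule)

lemma perm_rep_one: "f \<in> carrier (ell2 E) \<Longrightarrow> perm_rep G E \<phi> \<one> f = f"
  by (auto simp: perm_rep_apply carrier_ell2 fun_eq_iff simp flip: id_eq_one)

lemma perm_rep_in_unitaries:
  assumes g: "g \<in> carrier G"
  shows "perm_rep G E \<phi> g \<in> unitaries (ell2 E)"
proof -
  have cancel: "perm_rep G E \<phi> (inv g) (perm_rep G E \<phi> g f) = f"
    "perm_rep G E \<phi> g (perm_rep G E \<phi> (inv g) f) = f" if "f \<in> carrier (ell2 E)" for f
    using that g perm_rep_one by (simp_all flip: perm_rep_mult)
  have "bij_betw (perm_rep G E \<phi> g) (carrier (ell2 E)) (carrier (ell2 E))"
    by (rule bij_betwI[where g = "perm_rep G E \<phi> (inv g)"]) (use cancel g perm_rep_closed in auto)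
  then have "perm_rep G E \<phi> g \<in> Bij (carrier (ell2 E))"
    by (simp add: Bij_def perm_rep_def)
  moreover have "hinner (ell2 E) (perm_rep G E \<phi> g f) (perm_rep G E \<phi> g f') = hinner (ell2 E) f f'"
    if f: "f \<in> carrier (ell2 E)" "f' \<in> carrier (ell2 E)" for f f'
  proof -
    have "hinner (ell2 E) (perm_rep G E \<phi> g f) (perm_rep G E \<phi> g f')
        = (\<Sum>\<^sub>\<infinity>i\<in>E. f (\<phi> (inv g) i) * cnj (f' (\<phi> (inv g) i)))"
      using f by (auto simp: perm_rep_apply intro: infsum_cong)
    also have "\<dots> = (\<Sum>\<^sub>\<infinity>i\<in>E. f i * cnj (f' i))"
      using g by (intro infsum_reindex_bij_betw act_bij_betw) simp
    finally show ?thesis by simp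
  qed
  ultimately show ?thesis
    by (auto simp: unitaries_def perm_rep_apply ell2_add_closed ell2_smult_closed)
qed

lemma unitary_rep_perm_rep: "unitary_rep G (ell2 E) (perm_rep G E \<phi>)"
proof -
  have "perm_rep G E \<phi> \<in> hom G (unitary_group (ell2 E))"
  proof (rule homI)
    fix g h assume gh: "g \<in> carrier G" "h \<in> carrier G"
    have "perm_rep G E \<phi> g \<in> Bij (carrier (ell2 E))" "perm_rep G E \<phi> h \<in> Bij (carrier (ell2 E))"
      using perm_rep_in_unitaries gh by (auto simp: unitaries_def)
    moreover have "perm_rep G E \<phi> (g \<otimes> h) = compose (carrier (ell2 E)) (perm_rep G E \<phi> g) (perm_rep G E \<phi> h)"
    proof
      fix f
      show "perm_rep G E \<phi> (g \<otimes> h) f = compose (carrier (ell2 E)) (perm_rep G E \<phi> g) (perm_rep G E \<phi> h) f"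
        using perm_rep_mult[OF gh, of f]
        by (cases "f \<in> carrier (ell2 E)") (simp_all add: compose_def perm_rep_def)
    qed
    ultimately show "perm_rep G E \<phi> (g \<otimes> h) = perm_rep G E \<phi> g \<otimes>\<^bsub>unitary_group (ell2 E)\<^esub> perm_rep G E \<phi> h"
      by (simp add: unitary_group_def BijGroup_def)
  qed (simp add: unitary_group_def perm_rep_in_unitaries)
  then show ?thesis by (simp add: unitary_rep_def complex_hilbert_space_ell2)
qed

section \<open>Invariant vectors and almost invariant finite sets\<close>

lemma perm_rep_no_fixed_vectors:
  assumes "\<And>i. i \<in> E \<Longrightarrow> infinite (orbit G \<phi> i)"
  shows "fixed_vectors G (ell2 E) (perm_rep G E \<phi>) = {\<zero>\<^bsub>ell2 E\<^esub>}"
proof -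
  have "f = (\<lambda>i. 0)" if f: "f \<in> carrier (ell2 E)" and fixed: "\<And>g. g \<in> carrier G \<Longrightarrow> perm_rep G E \<phi> g f = f" for f
  proof (rule ccontr)
    assume "f \<noteq> (\<lambda>i. 0)"
    then obtain i where i: "f i \<noteq> 0" by auto
    then have iE: "i \<in> E" using f by (auto simp: carrier_ell2)
    \<comment> \<open>An invariant vector is constant on orbits. A nonzero constant on an infinite
      orbit is not square-summable, and the rest of the proof makes this quantitative.\<close>
    have const: "f j = f i" if "j \<in> orbit G \<phi> i" for j
    proof -
      obtain g where g: "g \<in> carrier G" "j = \<phi> g i" using \<open>j \<in> orbit G \<phi> i\<close> by (auto simp: orbit_def)
      have "f i = perm_rep G E \<phi> (inv g) f i" using fixed[of "inv g"] g by simp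
      then show ?thesis using f g iE by (simp add: perm_rep_apply)
    qed
    define c where "c = (cmod (f i))\<^sup>2"
    have c: "c > 0" using i by (simp add: c_def)
    obtain n :: nat where n: "(hnorm (ell2 E) f)\<^sup>2 / c < real n" using reals_Archimedean2 by blast
    obtain F where F: "F \<subseteq> orbit G \<phi> i" "finite F" "card F = n"
      using infinite_arbitrarily_large[OF assms[OF iE]] by blast
    have "F \<subseteq> E" using F(1) element_image iE by (auto simp: orbit_def)
    have "real n * c = (\<Sum>j\<in>F. (cmod (f j))\<^sup>2)"
      using F const by (simp add: c_def subset_iff)
    also have "\<dots> \<le> (hnorm (ell2 E) f)\<^sup>2" using hnorm_ell2_bound[OF f F(2) \<open>F \<subseteq> E\<close>] .
    finally show False using n c by (simp add: field_simps)
  qed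
  moreover have "perm_rep G E \<phi> g (\<lambda>i. 0) = (\<lambda>i. 0)" for g
    by (simp add: perm_rep_def carrier_ell2)
  ultimately show ?thesis by (auto simp: fixed_vectors_def carrier_ell2)
qed

lemma kazhdan_const_le_Folner:
  fixes F :: "'c set"
  assumes orbits: "\<And>i. i \<in> E \<Longrightarrow> infinite (orbit G \<phi> i)"
    and F: "finite F" "F \<subseteq> E" "F \<noteq> {}"
    and S: "finite S" "S \<noteq> {}" "S \<subseteq> carrier G"
    and almost: "\<And>s. s \<in> S \<Longrightarrow> card (sym_diff (\<phi> s ` F) F) \<le> k"
  shows "kazhdan_const TYPE('c \<Rightarrow> complex) G S \<le> ennreal (sqrt (real k / real (card F)))"
proof -
  define \<xi> where "\<xi> i = (if i \<in> F then complex_of_real (1 / sqrt (card F)) else 0)" for i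
  have cF: "card F > 0" using F by (simp add: card_gt_0_iff)
  have n\<xi>: "(cmod (\<xi> i))\<^sup>2 = (if i \<in> F then 1 / card F else 0)" for i
    by (simp add: \<xi>_def norm_divide power_divide)
  have \<xi>: "\<xi> \<in> carrier (ell2 E)" "hnorm (ell2 E) \<xi> = 1"
    using hnorm_ell2_finite_support[of F E \<xi>] F cF by (simp_all add: n\<xi>) (simp_all add: \<xi>_def)
  have bound: "hnorm (ell2 E) (perm_rep G E \<phi> s \<xi> \<ominus>\<^bsub>ell2 E\<^esub> \<xi>) \<le> sqrt (real k / real (card F))"
    if s: "s \<in> S" for s
  proof -
    have sc: "s \<in> carrier G" using s S by blast
    \<comment> \<open>Precomposing with \<open>\<phi> (inv s)\<close> turns the indicator of
      \<open>F\<close> into that of its image under \<open>s\<close>.\<close>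
    have img: "\<phi> (inv s) i \<in> F \<longleftrightarrow> i \<in> \<phi> s ` F" if "i \<in> E" for i
    proof -
      have "\<phi> s (\<phi> (inv s) i) = i" using composition_rule[OF that sc, of "inv s"] sc that id_eq_one
        by (metis inv_closed r_inv restrict_apply')
      moreover have "\<phi> (inv s) (\<phi> s j) = j" if "j \<in> F" for j
        using composition_rule[of j "inv s" s] sc that F id_eq_one
        by (metis inv_closed l_inv restrict_apply' subsetD)
      ultimately show ?thesis by force
    qed
    have sFE: "\<phi> s ` F \<subseteq> E" using F sc element_image by blast
    define \<eta> where "\<eta> = perm_rep G E \<phi> s \<xi> \<ominus>\<^bsub>ell2 E\<^esub> \<xi>"
    have \<eta>: "\<eta> i = (if i \<in> \<phi> s ` F then complex_of_real (1 / sqrt (card F)) else 0) - \<xi> i" for i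
      using ell2_minus[OF perm_rep_closed[OF sc \<xi>(1)] \<xi>(1)] \<xi>(1) img[of i] sFE
      by (auto simp: \<eta>_def perm_rep_apply \<xi>_def)
    let ?D = "sym_diff (\<phi> s ` F) F"
    have "(cmod (\<eta> i))\<^sup>2 = 1 / card F" if "i \<in> ?D" for i
      using that by (auto simp: \<eta> \<xi>_def norm_divide power_divide)
    then have "(\<Sum>i\<in>?D. (cmod (\<eta> i))\<^sup>2) = real (card ?D) / real (card F)" by simp
    moreover have "hnorm (ell2 E) \<eta> = sqrt (\<Sum>i\<in>?D. (cmod (\<eta> i))\<^sup>2)"
      using F sFE by (intro hnorm_ell2_finite_support) (auto simp: \<eta> \<xi>_def)
    ultimately have "hnorm (ell2 E) \<eta> = sqrt (real (card ?D) / real (card F))" by simp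
    also have "\<dots> \<le> sqrt (real k / real (card F))"
      using almost[OF s] by (intro real_sqrt_le_mono divide_right_mono) auto
    finally show ?thesis by (simp add: \<eta>_def)
  qed
  have "\<xi> \<noteq> \<zero>\<^bsub>ell2 E\<^esub>" using F by (auto simp: \<xi>_def fun_eq_iff)
  then have "unitary_rep G (ell2 E) (perm_rep G E \<phi>) \<and> carrier (ell2 E) \<noteq> {\<zero>\<^bsub>ell2 E\<^esub>} \<and>
      fixed_vectors G (ell2 E) (perm_rep G E \<phi>) = {\<zero>\<^bsub>ell2 E\<^esub>}"
    using \<xi>(1) unitary_rep_perm_rep perm_rep_no_fixed_vectors[OF orbits] by auto
  then have "kazhdan_const TYPE('c \<Rightarrow> complex) G S
      \<le> (INF \<xi> \<in> {\<xi> \<in> carrier (ell2 E). hnorm (ell2 E) \<xi> = 1}.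
          MAX s\<in>S. ennreal (hnorm (ell2 E) (perm_rep G E \<phi> s \<xi> \<ominus>\<^bsub>ell2 E\<^esub> \<xi>)))"
    unfolding kazhdan_const_def by (intro INF_lower2[of "(ell2 E, perm_rep G E \<phi>)"]) auto
  also have "\<dots> \<le> (MAX s\<in>S. ennreal (hnorm (ell2 E) (perm_rep G E \<phi> s \<xi> \<ominus>\<^bsub>ell2 E\<^esub> \<xi>)))"
    using \<xi> by (intro INF_lower) simp
  also have "\<dots> \<le> ennreal (sqrt (real k / real (card F)))"
    using S bound by (subst Max_le_iff) (auto intro: ennreal_leI)
  finally show ?thesis .
qed

end


section \<open>Groups, actions and cosets\<close>

text \<open>\<open>group_action\<close> asks for a homomorphism into \<open>BijGroup E\<close>,
  whose elements are extensional. Bijectivity follows from the multiplicative laws, with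
  \<open>\<psi> (inv g)\<close> as the inverse map.\<close>

lemma group_actionI:
  fixes G (structure)
  assumes "group G"
    and closed: "\<And>g x. g \<in> carrier G \<Longrightarrow> x \<in> E \<Longrightarrow> \<psi> g x \<in> E"
    and ext: "\<And>g. g \<in> carrier G \<Longrightarrow> \<psi> g \<in> extensional E"
    and one: "\<And>x. x \<in> E \<Longrightarrow> \<psi> \<one> x = x"
    and mult: "\<And>g h x. g \<in> carrier G \<Longrightarrow> h \<in> carrier G \<Longrightarrow> x \<in> E \<Longrightarrow> \<psi> (g \<otimes> h) x = \<psi> g (\<psi> h x)"
  shows "group_action G E \<psi>"
proof -
  interpret group G by fact
  have Bij: "\<psi> g \<in> Bij E" if g: "g \<in> carrier G" for g
  proof -
    have "bij_betw (\<psi> g) E E"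
      by (rule bij_betwI[where g = "\<psi> (inv g)"]) (use closed one g in \<open>auto simp flip: mult\<close>)
    then show ?thesis using ext g by (simp add: Bij_def)
  qed
  have "\<psi> \<in> hom G (BijGroup E)"
  proof (rule homI)
    fix g h assume gh: "g \<in> carrier G" "h \<in> carrier G"
    have "\<psi> (g \<otimes> h) x = compose E (\<psi> g) (\<psi> h) x" for x
      using gh mult ext extensional_arb[OF ext[of "g \<otimes> h"]] by (cases "x \<in> E") (auto simp: compose_def)
    then show "\<psi> (g \<otimes> h) = \<psi> g \<otimes>\<^bsub>BijGroup E\<^esub> \<psi> h" using Bij gh by (auto simp: BijGroup_def)
  qed (simp add: BijGroup_def Bij)
  then show ?thesis
    by (simp add: group_action.intro group_hom.intro group_hom_axioms.intro group_BijGroup is_group)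
qed

text \<open>Every element is the product of a finite word in the generators and their inverses, and
  there are countably many words.\<close>

lemma (in group) countable_generate:
  assumes "countable S" "S \<subseteq> carrier G"
  shows "countable (generate G S)"
proof -
  define A where "A = S \<union> m_inv G ` S"
  have A: "A \<subseteq> carrier G" using assms by (auto simp: A_def)
  have prod: "foldr (\<otimes>) xs \<one> \<in> carrier G" if "set xs \<subseteq> A" for xs
    using that A by (induction xs) auto
  have append: "foldr (\<otimes>) (xs @ ys) \<one> = foldr (\<otimes>) xs \<one> \<otimes> foldr (\<otimes>) ys \<one>"
    if "set xs \<subseteq> A" "set ys \<subseteq> A" for xs ys
    using that prod A by (induction xs) (auto simp: m_assoc subset_iff)
  have "g \<in> (\<lambda>xs. foldr (\<otimes>) xs \<one>) ` lists A" if "g \<in> generate G S" for g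
    using that
  proof (induction rule: generate.induct)
    case one
    show ?case by (rule image_eqI[of _ _ "[]"]) auto
  next
    case (incl h)
    then show ?case using assms by (intro image_eqI[of _ _ "[h]"]) (auto simp: A_def)
  next
    case (inv h)
    then show ?case using assms by (intro image_eqI[of _ _ "[inv h]"]) (auto simp: A_def)
  next
    case (eng h1 h2)
    then obtain xs ys where "xs \<in> lists A" "ys \<in> lists A"
      "h1 = foldr (\<otimes>) xs \<one>" "h2 = foldr (\<otimes>) ys \<one>" by blast
    moreover from this have "foldr (\<otimes>) (xs @ ys) \<one> = h1 \<otimes> h2" using append[of xs ys] by auto
    ultimately show ?case by (intro image_eqI[of _ _ "xs @ ys"]) auto
  qed
  then have "generate G S \<subseteq> (\<lambda>xs. foldr (\<otimes>) xs \<one>) ` lists A" by blast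
  moreover have "countable (lists A)" using assms by (simp add: A_def)
  ultimately show ?thesis using countable_subset countable_image by metis
qed

text \<open>Allows the countable coset space to be relabelled inside the prescribed infinite type
  \<open>'i\<close>.\<close>

lemma countable_imp_inj_on_infinite:
  fixes B :: "'a set"
  assumes "countable B"
  obtains e :: "'a \<Rightarrow> 'i::infinite" where "inj_on e B"
proof -
  obtain f :: "nat \<Rightarrow> 'i" where f: "inj f"
    using infinite_countable_subset[OF infinite_UNIV] by blast
  have "inj_on (f \<circ> to_nat_on B) B"
    using inj_on_to_nat_on[OF assms] f by (auto intro: comp_inj_on inj_on_subset)
  then show thesis using that by blast
qed

lemma (in group) lcos_eq_iff:
  assumes "subgroup H G" "x \<in> carrier G" "y \<in> carrier G"
  shows "x <# H = y <# H \<longleftrightarrow> inv x \<otimes> y \<in> H"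
proof -
  interpret H: subgroup H G by fact
  have "inv x \<otimes> y \<in> H" if "x <# H = y <# H"
  proof -
    have "y \<otimes> \<one> \<in> y <# H" using H.one_closed unfolding l_coset_def by blast
    then have "y \<in> x <# H" using that assms by simp
    then obtain h where "h \<in> H" "y = x \<otimes> h" by (auto simp: l_coset_def)
    then show ?thesis using assms H.subset by (auto simp flip: m_assoc)
  qed
  moreover have "x <# H = y <# H" if h: "inv x \<otimes> y \<in> H"
  proof -
    have "y = x \<otimes> (inv x \<otimes> y)" using assms by (simp flip: m_assoc)
    then have "y <# H = x <# ((inv x \<otimes> y) <# H)"
      using lcos_m_assoc[OF H.subset] assms by simp
    also have "(inv x \<otimes> y) <# H = H" using coset_join3[OF _ assms(1) h] assms by simp
    finally show ?thesis by simp
  qed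
  ultimately show ?thesis by blast
qed


section \<open>Convergence actions\<close>

text \<open>Induction: separate the new point from the compact set of old points, then intersect the
  old neighbourhoods with the open set on their side.\<close>

lemma finite_points_disjoint_nbhds:
  assumes "Hausdorff_space T" "finite Q" "Q \<subseteq> topspace T"
  obtains U where "\<And>q. q \<in> Q \<Longrightarrow> openin T (U q) \<and> q \<in> U q"
    "\<And>q q'. q \<in> Q \<Longrightarrow> q' \<in> Q \<Longrightarrow> q \<noteq> q' \<Longrightarrow> U q \<inter> U q' = {}"
proof -
  have "\<exists>U. (\<forall>q\<in>Q. openin T (U q) \<and> q \<in> U q) \<and> (\<forall>q\<in>Q. \<forall>q'\<in>Q. q \<noteq> q' \<longrightarrow> U q \<inter> U q' = {})"
    using assms(2,3)
  proof (induction Q)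
    case empty
    then show ?case by simp
  next
    case (insert x Q)
    then obtain U where U: "\<forall>q\<in>Q. openin T (U q) \<and> q \<in> U q"
        "\<forall>q\<in>Q. \<forall>q'\<in>Q. q \<noteq> q' \<longrightarrow> U q \<inter> U q' = {}"
      by auto
    have "compactin T {x}" "compactin T Q"
      using insert by (auto simp: finite_imp_compactin)
    then obtain A B where AB: "openin T A" "openin T B" "{x} \<subseteq> A" "Q \<subseteq> B" "disjnt A B"
      using \<open>Hausdorff_space T\<close> \<open>x \<notin> Q\<close> unfolding Hausdorff_space_compact_sets
      by (metis disjnt_insert1 disjnt_empty1)
    define V where "V = (\<lambda>q. if q = x then A else U q \<inter> B)"
    have "\<forall>q\<in>insert x Q. openin T (V q) \<and> q \<in> V q"
      using U(1) AB by (auto simp: V_def)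
    moreover have "V q \<inter> V q' = {}" if "q \<in> insert x Q" "q' \<in> insert x Q" "q \<noteq> q'" for q q'
      using U(2) AB that by (auto simp: V_def disjnt_def)
    ultimately show ?case by blast
  qed
  then show thesis using that by metis
qed

locale convergence_group = group G for G (structure) +
  fixes T :: "'x topology" and \<phi> :: "'a \<Rightarrow> 'x \<Rightarrow> 'x"
  assumes compact: "compact_space T"
    and Hausdorff: "Hausdorff_space T"
    and conv: "convergence_action G T \<phi>"
    and nonelem: "non_elementary G T \<phi>"
begin

sublocale group_action G "topspace T" \<phi>
  using conv by (simp add: convergence_action_def acts_by_homeomorphisms_def)

lemma act_closed [simp]: "g \<in> carrier G \<Longrightarrow> x \<in> topspace T \<Longrightarrow> \<phi> g x \<in> topspace T"
  using element_image by blast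

lemma act_one [simp]: "x \<in> topspace T \<Longrightarrow> \<phi> \<one> x = x"
  using id_eq_one by (metis restrict_apply')

lemma act_inv_cancel [simp]:
  assumes "g \<in> carrier G" "x \<in> topspace T"
  shows "\<phi> (inv g) (\<phi> g x) = x" "\<phi> g (\<phi> (inv g) x) = x"
  using assms by (simp_all flip: composition_rule)

lemma act_inj: "\<phi> g x = \<phi> g y \<longleftrightarrow> x = y"
  if "g \<in> carrier G" "x \<in> topspace T" "y \<in> topspace T"
  using that act_inv_cancel(1) by metis

lemma act_continuous: "g \<in> carrier G \<Longrightarrow> continuous_map T T (\<phi> g)"
  using conv homeomorphic_imp_continuous_map
  by (auto simp: convergence_action_def acts_by_homeomorphisms_def)

lemma openin_act_preimage:
  "g \<in> carrier G \<Longrightarrow> openin T U \<Longrightarrow> openin T {x \<in> topspace T. \<phi> g x \<in> U}"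
  using act_continuous openin_continuous_map_preimage by blast

lemma limit_set_subset: "limit_set G T \<phi> \<subseteq> topspace T"
  by (auto simp: limit_set_def collapses_to_def)

lemma limit_set_not_subset:
  assumes "finite F" "card F \<le> 2"
  shows "\<not> limit_set G T \<phi> \<subseteq> F"
  using nonelem assms card_mono[of F "limit_set G T \<phi>"] finite_subset[of "limit_set G T \<phi>" F]
  unfolding non_elementary_def by auto

lemma other_limit_point: obtains x where "x \<in> limit_set G T \<phi>" "x \<noteq> a" "x \<noteq> b"
proof -
  have "card {a,b} \<le> 2" by (simp add: card_insert_if)
  then show thesis using limit_set_not_subset[of "{a,b}"] that by auto
qed

lemma other_point: obtains x where "x \<in> topspace T" "x \<noteq> a" "x \<noteq> b"
  using other_limit_point limit_set_subset by (metis subsetD)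

section \<open>Collapsing sequences and their poles\<close>

lemma convergence_subseq:
  assumes "distinct_seq G g"
  obtains \<sigma> r a where "strict_mono (\<sigma> :: nat \<Rightarrow> nat)" "collapses_to T \<phi> (g \<circ> \<sigma>) r a"
  using conv assms unfolding convergence_action_def by blast

lemma collapses_subseq:
  assumes "collapses_to T \<phi> g r a" "strict_mono (\<sigma> :: nat \<Rightarrow> nat)"
  shows "collapses_to T \<phi> (g \<circ> \<sigma>) r a"
  using assms eventually_subseq[OF assms(2)] unfolding collapses_to_def by fastforce

lemma collapses_limitin:
  assumes "collapses_to T \<phi> g r a" "x \<in> topspace T" "x \<noteq> r"
  shows "limitin T (\<lambda>n. \<phi> (g n) x) a sequentially"
proof -
  have "compactin T {x}" "r \<notin> {x}" using assms by auto
  then have "\<forall>\<^sub>F n in sequentially. \<phi> (g n) ` {x} \<subseteq> U" if "openin T U" "a \<in> U" for U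
    using assms(1) that unfolding collapses_to_def by blast
  then show ?thesis
    using assms(1) by (simp add: limitin_def collapses_to_def)
qed

lemma limitin_unique:
  "limitin T f l sequentially \<Longrightarrow> limitin T f l' sequentially \<Longrightarrow> l = l'"
  using limitin_Hausdorff_unique[OF _ _ trivial_limit_sequentially Hausdorff] .

lemma limitin_in_closed:
  "closedin T C \<Longrightarrow> limitin T f l sequentially \<Longrightarrow> \<forall>\<^sub>F n in sequentially. f n \<in> C \<Longrightarrow> l \<in> C"
  using limitin_closedin[OF _ _ _ trivial_limit_sequentially] .

lemma closedin_finite: "finite F \<Longrightarrow> F \<subseteq> topspace T \<Longrightarrow> closedin T F"
  using Hausdorff Hausdorff_imp_t1_space t1_space_closedin_finite by blast

text \<open>\<open>g\<close> maps the complement of \<open>U\<close> into the complement of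
  \<open>C\<close> exactly when its inverse maps \<open>C\<close> into \<open>U\<close>. In a
  compact Hausdorff space compact and closed sets coincide, so the two conditions are dual.\<close>

lemma collapses_inverse:
  assumes "collapses_to T \<phi> g r a" "distinct_seq G g"
  shows "collapses_to T \<phi> (\<lambda>n. inv (g n)) a r"
proof -
  have *: "\<forall>\<^sub>F n in sequentially. \<phi> (inv (g n)) ` C \<subseteq> U"
    if C: "compactin T C" "a \<notin> C" and U: "openin T U" "r \<in> U" for C U
  proof -
    have "closedin T C" using C Hausdorff compactin_imp_closedin by blast
    moreover have "compactin T (topspace T - U)"
      using U compact closedin_compact_space by blast
    ultimately have "\<forall>\<^sub>F n in sequentially. \<phi> (g n) ` (topspace T - U) \<subseteq> topspace T - C"
      using assms(1) C U unfolding collapses_to_def by (auto simp: closedin_def)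
    then show ?thesis
    proof eventually_elim
      case (elim n)
      have g: "g n \<in> carrier G" using assms(2) by (auto simp: distinct_seq_def)
      show ?case
      proof
        fix y assume "y \<in> \<phi> (inv (g n)) ` C"
        then obtain c where c: "c \<in> C" "y = \<phi> (inv (g n)) c" by blast
        then have "c \<in> topspace T" using C compactin_subset_topspace by blast
        then have "\<phi> (g n) y = c" "y \<in> topspace T" using c g by auto
        then show "y \<in> U" using elim c by auto
      qed
    qed
  qed
  show ?thesis using assms * unfolding collapses_to_def by auto
qed

lemma collapses_translate:
  assumes "collapses_to T \<phi> g r a" "range g \<subseteq> carrier G" "h \<in> carrier G" "k \<in> carrier G"
  shows "collapses_to T \<phi> (\<lambda>n. h \<otimes> g n \<otimes> k) (\<phi> (inv k) r) (\<phi> h a)"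
proof -
  have ra: "r \<in> topspace T" "a \<in> topspace T" using assms by (auto simp: collapses_to_def)
  have "\<forall>\<^sub>F n in sequentially. \<phi> (h \<otimes> g n \<otimes> k) ` C \<subseteq> U"
    if C: "compactin T C" "\<phi> (inv k) r \<notin> C" and U: "openin T U" "\<phi> h a \<in> U" for C U
  proof -
    have CX: "C \<subseteq> topspace T" using C compactin_subset_topspace by blast
    have "compactin T (\<phi> k ` C)" using C act_continuous assms image_compactin by blast
    moreover have "r \<notin> \<phi> k ` C"
      using C CX assms(4) by auto
    moreover have "openin T {x \<in> topspace T. \<phi> h x \<in> U}"
      using openin_act_preimage assms U by blast
    ultimately have "\<forall>\<^sub>F n in sequentially. \<phi> (g n) ` \<phi> k ` C \<subseteq> {x \<in> topspace T. \<phi> h x \<in> U}"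
      using assms(1) U ra unfolding collapses_to_def by auto
    then show ?thesis
    proof eventually_elim
      case (elim n)
      have "g n \<in> carrier G" using assms by auto
      then show ?case using elim CX assms by (auto simp: composition_rule subset_iff)
    qed
  qed
  then show ?thesis using ra assms unfolding collapses_to_def by auto
qed

text \<open>Any point away from both repelling points converges to both attracting points, and
  limits are unique.\<close>

lemma attractor_unique:
  assumes "collapses_to T \<phi> g r a" "collapses_to T \<phi> g r' a'"
  shows "a = a'"
proof -
  obtain x where "x \<in> topspace T" "x \<noteq> r" "x \<noteq> r'" using other_point .
  then show ?thesis using assms collapses_limitin limitin_unique by blast
qed

lemma repeller_unique:
  assumes "collapses_to T \<phi> g r a" "collapses_to T \<phi> g r' a'" "distinct_seq G g"
  shows "r = r'"
  using assms collapses_inverse attractor_unique by blast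

text \<open>Conjugation by \<open>t\<close> leaves the sequence unchanged but moves its poles to
  \<open>\<phi> t r\<close> and \<open>\<phi> t a\<close>; uniqueness of the poles
  concludes.\<close>

lemma commuting_fixes:
  assumes "collapses_to T \<phi> g r a" "distinct_seq G g" "t \<in> carrier G" "\<And>n. t \<otimes> g n = g n \<otimes> t"
  shows "\<phi> t r = r" "\<phi> t a = a"
proof -
  have g: "range g \<subseteq> carrier G" using assms by (simp add: distinct_seq_def)
  then have g': "g n \<in> carrier G" for n by auto
  have ra: "r \<in> topspace T" "a \<in> topspace T" using assms by (auto simp: collapses_to_def)
  have "(\<lambda>n. t \<otimes> g n \<otimes> inv t) = g"
    using assms g' by (simp add: m_assoc)
  then have "collapses_to T \<phi> g (\<phi> t r) (\<phi> t a)"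
    using collapses_translate[OF assms(1) g assms(3), of "inv t"] assms(3) by simp
  then show "\<phi> t r = r" "\<phi> t a = a"
    using assms attractor_unique repeller_unique by blast+
qed


text \<open>\<open>C\<close> is the complement of a neighbourhood of \<open>r\<close> and
  \<open>U\<close> a neighbourhood of \<open>a\<close>. The point \<open>c\<close> certifies that
  \<open>C\<close> is mapped strictly into itself, which later forces infinite order.\<close>

lemma collapses_attracting_region:
  assumes "collapses_to T \<phi> g r a" "r \<noteq> a" "c \<in> topspace T" "c \<noteq> r" "c \<noteq> a"
  obtains C U where "closedin T C" "openin T U" "U \<subseteq> C" "r \<notin> C" "c \<in> C - U"
    "\<forall>\<^sub>F n in sequentially. \<phi> (g n) ` C \<subseteq> U"
proof -
  have ra: "r \<in> topspace T" "a \<in> topspace T" using assms by (auto simp: collapses_to_def)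
  obtain W where W: "\<And>q. q \<in> {r,a,c} \<Longrightarrow> openin T (W q) \<and> q \<in> W q"
    "\<And>q q'. q \<in> {r,a,c} \<Longrightarrow> q' \<in> {r,a,c} \<Longrightarrow> q \<noteq> q' \<Longrightarrow> W q \<inter> W q' = {}"
    using finite_points_disjoint_nbhds[OF Hausdorff, of "{r,a,c}"] ra assms by auto
  define C where "C = topspace T - W r"
  have C: "closedin T C" "r \<notin> C" using W by (auto simp: C_def)
  have sub: "W a \<subseteq> C" using W(1)[of a] W(2)[of a r] assms(2) openin_subset[of T "W a"] by (auto simp: C_def)
  have "c \<in> C - W a" using W(1)[of c] W(2)[of c r] W(2)[of c a] assms by (auto simp: C_def)
  moreover have "\<forall>\<^sub>F n in sequentially. \<phi> (g n) ` C \<subseteq> W a"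
    using assms(1) W(1)[of a] C closedin_compact_space[OF compact C(1)] unfolding collapses_to_def by auto
  ultimately show thesis using that C sub W(1)[of a] by blast
qed

lemma power_act_mem:
  assumes "g \<in> carrier G" "C \<subseteq> topspace T" "\<phi> g ` C \<subseteq> C" "c \<in> C"
  shows "\<phi> (g [^] (n::nat)) c \<in> C"
proof (induction n)
  case 0
  then show ?case using assms by (auto simp: subset_iff)
next
  case (Suc n)
  have "\<phi> (g [^] Suc n) c = \<phi> g (\<phi> (g [^] n) c)"
    using assms nat_pow_Suc2[OF assms(1), of n] by (auto simp: composition_rule subset_iff)
  then show ?case using Suc assms by auto
qed

text \<open>\<open>ord g = 0\<close> encodes infinite order. If some positive power of
  \<open>g\<close> were trivial, then, since all powers preserve \<open>C\<close>, every point of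
  \<open>C\<close> would lie in the image of \<open>C\<close>, against strictness.\<close>

lemma ord_eq_0_if_contracts:
  assumes "g \<in> carrier G" "C \<subseteq> topspace T" "\<phi> g ` C \<subset> C"
  shows "ord g = 0"
proof (rule ccontr)
  assume "ord g \<noteq> 0"
  then obtain n where n: "ord g = Suc n" using not0_implies_Suc by blast
  have "C \<subseteq> \<phi> g ` C"
  proof
    fix c assume c: "c \<in> C"
    have "g [^] Suc n = \<one>" using n assms(1) pow_ord_eq_1 by metis
    then have "c = \<phi> (g [^] Suc n) c" using c assms by auto
    also have "\<dots> = \<phi> g (\<phi> (g [^] n) c)"
      using assms c nat_pow_Suc2[OF assms(1), of n] by (auto simp: composition_rule subset_iff)
    finally show "c \<in> \<phi> g ` C"
      using power_act_mem[OF assms(1,2) _ c, of n] assms(3) by blast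
  qed
  then show False using assms by blast
qed

lemma distinct_seq_powers:
  assumes "t \<in> carrier G" "ord t = 0" "strict_mono (e :: nat \<Rightarrow> nat)"
  shows "distinct_seq G (\<lambda>n. t [^] e n)"
proof -
  have "inj (\<lambda>n. t [^] e n)"
  proof (rule injI)
    fix m n assume "t [^] e m = t [^] e n"
    then have "e m = e n" using assms(1,2)
      by (metis int_pow_int int_pow_eq dvd_0_left_iff of_nat_0 right_minus_eq of_nat_eq_iff)
    then show "m = n" using assms(3) strict_mono_eq by blast
  qed
  then show ?thesis using assms by (auto simp: distinct_seq_def)
qed

text \<open>The poles are fixed because \<open>t\<close> commutes with its own powers.\<close>

lemma powers_collapse:
  assumes "t \<in> carrier G" "ord t = 0" "strict_mono (e :: nat \<Rightarrow> nat)"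
  obtains \<sigma> r a where "strict_mono (\<sigma> :: nat \<Rightarrow> nat)" "collapses_to T \<phi> (\<lambda>n. t [^] e (\<sigma> n)) r a"
    "\<phi> t r = r" "\<phi> t a = a"
proof -
  obtain \<sigma> r a where *: "strict_mono (\<sigma> :: nat \<Rightarrow> nat)" "collapses_to T \<phi> (\<lambda>n. t [^] e (\<sigma> n)) r a"
    using convergence_subseq[OF distinct_seq_powers[OF assms]] by (auto simp: o_def)
  have "strict_mono (\<lambda>n. e (\<sigma> n))" using * assms(3) by (simp add: strict_mono_def)
  then have d: "distinct_seq G (\<lambda>n. t [^] e (\<sigma> n))"
    using distinct_seq_powers assms by blast
  have "t \<otimes> t [^] e (\<sigma> n) = t [^] e (\<sigma> n) \<otimes> t" for n
    using assms nat_pow_Suc2[of t] by simp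
  then show thesis using that * commuting_fixes[OF *(2) d assms(1)] by blast
qed

lemma act_power_dvd:
  assumes "t \<in> carrier G" "x \<in> topspace T" "\<phi> (t [^] (m::nat)) x = x" "m dvd n"
  shows "\<phi> (t [^] n) x = x"
proof -
  obtain k where "n = m * k" using assms by blast
  moreover have "\<phi> (t [^] (m * k)) x = x" for k
    by (induction k) (use assms in \<open>auto simp: composition_rule simp flip: nat_pow_mult\<close>)
  ultimately show ?thesis by blast
qed

text \<open>Passing to the powers \<open>t ^ n!\<close> catches the periodic points of all periods at once.\<close>

lemma periodic_points:
  assumes "t \<in> carrier G" "ord t = 0"
  obtains e r a where "strict_mono (e :: nat \<Rightarrow> nat)" "collapses_to T \<phi> (\<lambda>n. t [^] e n) r a"
    "\<phi> t r = r" "\<phi> t a = a"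
    "\<And>x m. x \<in> topspace T \<Longrightarrow> 0 < m \<Longrightarrow> \<phi> (t [^] (m::nat)) x = x \<Longrightarrow> x = r \<or> x = a"
proof -
  \<comment> \<open>The shift by \<open>Suc\<close> is essential here:
    \<open>fact 0 = fact 1\<close>.\<close>
  have mono: "strict_mono (\<lambda>n. fact (Suc n) :: nat)"
    by (rule strict_monoI) (metis fact_less_mono_nat Suc_less_eq zero_less_Suc)
  obtain \<sigma> r a where *: "strict_mono (\<sigma> :: nat \<Rightarrow> nat)" "collapses_to T \<phi> (\<lambda>n. t [^] (fact (Suc (\<sigma> n)) :: nat)) r a"
    "\<phi> t r = r" "\<phi> t a = a"
    using powers_collapse[OF assms mono] .
  have "x = r \<or> x = a" if x: "x \<in> topspace T" "0 < m" "\<phi> (t [^] m) x = x" for x and m :: nat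
  proof (rule ccontr)
    assume neg: "\<not> (x = r \<or> x = a)"
    then have lim: "limitin T (\<lambda>n. \<phi> (t [^] (fact (Suc (\<sigma> n)) :: nat)) x) a sequentially"
      using collapses_limitin *(2) x by blast
    have ev: "\<phi> (t [^] (fact (Suc (\<sigma> n)) :: nat)) x = x" if "n \<ge> m" for n
    proof -
      have "n \<le> \<sigma> n" using *(1) seq_suble by blast
      then have "m dvd fact (Suc (\<sigma> n))" using x that by (intro dvd_fact) auto
      then show ?thesis using act_power_dvd assms x by blast
    qed
    have "\<forall>\<^sub>F n in sequentially. \<phi> (t [^] (fact (Suc (\<sigma> n)) :: nat)) x \<in> {x}"
      using ev by (auto simp: eventually_sequentially)
    then have "a \<in> {x}" using limitin_in_closed[OF closedin_finite lim] x by blast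
    then show False using neg by auto
  qed
  moreover have "strict_mono (\<lambda>n. fact (Suc (\<sigma> n)) :: nat)"
    using * mono by (simp add: strict_mono_def)
  ultimately show thesis using that * by blast
qed

lemma collapses_fixed_point:
  assumes "collapses_to T \<phi> g r a" "p \<in> topspace T" "\<And>n. \<phi> (g n) p = p" "p \<noteq> r"
  shows "a = p"
proof -
  have "limitin T (\<lambda>n. p) a sequentially" using collapses_limitin[OF assms(1,2,4)] assms(3) by simp
  moreover have "limitin T (\<lambda>n. p) p sequentially" using assms by simp
  ultimately show ?thesis using limitin_unique by blast
qed

end


section \<open>No global fixed point, and infinite orbits\<close>

lemma strict_mono_subseq_at_top:
  fixes f :: "nat \<Rightarrow> nat"
  assumes "filterlim f at_top sequentially"
  obtains \<rho> :: "nat \<Rightarrow> nat" where "strict_mono \<rho>" "strict_mono (f \<circ> \<rho>)"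
proof -
  have "\<exists>n'>n. f n < f n'" for n
    using assms unfolding filterlim_at_top eventually_sequentially
    by (metis Suc_le_eq le_cases lessI order_less_le_trans le_SucI)
  then have "\<exists>\<rho>. \<forall>n. True \<and> (\<rho> n < \<rho> (Suc n) \<and> f (\<rho> n) < f (\<rho> (Suc n)))"
    using dependent_nat_choice[of "\<lambda>_ _. True" "\<lambda>_ n n'. n < n' \<and> f n < f n'"] by auto
  then show thesis using that by (auto simp: strict_mono_Suc_iff)
qed

context convergence_group
begin

text \<open>
  If \<open>G\<close> fixed \<open>p\<close>, there would be \<open>\<gamma>\<close> with repelling fixed point \<open>p\<close> and attracting
  fixed point \<open>q \<noteq> p\<close>, and \<open>h\<close> moving \<open>q\<close> to some \<open>x \<noteq> q\<close>. The elements
  \<open>\<gamma>^l h \<gamma>^-n\<close>, with \<open>l\<close> minimal such that \<open>x\<close> is brought back into a neighbourhood of \<open>q\<close>, fix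
  \<open>p\<close> and keep the images of \<open>p\<close>, \<open>q\<close>, \<open>x\<close> apart, which no collapsing sequence does.
\<close>

lemma no_global_fixed_point:
  assumes p: "p \<in> topspace T" "\<And>g. g \<in> carrier G \<Longrightarrow> \<phi> g p = p"
  shows False
proof -
  obtain q1 where q1: "q1 \<in> limit_set G T \<phi>" "q1 \<noteq> p" using other_limit_point[of p p] by blast
  obtain q2 where q2: "q2 \<in> limit_set G T \<phi>" "q2 \<noteq> p" "q2 \<noteq> q1" using other_limit_point[of p q1] by blast
  have q2X: "q2 \<in> topspace T" using limit_set_subset q2 by blast
  obtain g r1 where g: "distinct_seq G g" "collapses_to T \<phi> g r1 q1"
    using q1 by (auto simp: limit_set_def)
  have gc: "g n \<in> carrier G" for n using g by (auto simp: distinct_seq_def)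
  \<comment> \<open>Otherwise the fixed point \<open>p\<close> would have to be the attracting point
    \<open>q1\<close>.\<close>
  have "r1 = p" using collapses_fixed_point[OF g(2) p(1)] p(2)[OF gc] q1 by blast
  with g have "collapses_to T \<phi> g p q1" by simp
  then obtain C U where C: "closedin T C" "openin T U" "U \<subseteq> C" "p \<notin> C" "q2 \<in> C - U"
    "\<forall>\<^sub>F n in sequentially. \<phi> (g n) ` C \<subseteq> U"
    using collapses_attracting_region q1 q2 q2X by metis
  then obtain n0 where n0: "\<phi> (g n0) ` C \<subseteq> U" by (auto simp: eventually_sequentially)
  define \<gamma> where "\<gamma> = g n0"
  have \<gamma>: "\<gamma> \<in> carrier G" "\<phi> \<gamma> ` C \<subseteq> U" using gc n0 by (auto simp: \<gamma>_def)
  have CX: "C \<subseteq> topspace T" using C closedin_subset by blast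
  have fw: "\<phi> (\<gamma> [^] (n::nat)) c \<in> C" if "c \<in> C" for c n
    using power_act_mem[OF \<gamma>(1) CX _ that] \<gamma> C by blast
  have "\<phi> \<gamma> ` C \<subset> C" using \<gamma> C by blast
  then have ord: "ord \<gamma> = 0" using ord_eq_0_if_contracts \<gamma> CX by blast
  obtain e r q where e: "strict_mono (e :: nat \<Rightarrow> nat)" "collapses_to T \<phi> (\<lambda>n. \<gamma> [^] e n) r q"
    "\<phi> \<gamma> r = r" "\<phi> \<gamma> q = q"
    and per: "\<And>x m. x \<in> topspace T \<Longrightarrow> 0 < m \<Longrightarrow> \<phi> (\<gamma> [^] (m::nat)) x = x \<Longrightarrow> x = r \<or> x = q"
    using periodic_points[OF \<gamma>(1) ord] by blast
  have rq: "r \<in> topspace T" "q \<in> topspace T" using e by (auto simp: collapses_to_def)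
  have "\<phi> \<gamma> q2 \<in> U" using \<gamma> C by blast
  \<comment> \<open>\<open>\<gamma>\<close> sends \<open>q2\<close>, which is outside
    \<open>U\<close>, into \<open>U\<close>, so \<open>q2\<close> is not fixed.\<close>
  then have "q2 \<noteq> r" using e(3) C by auto
  then have lim: "limitin T (\<lambda>n. \<phi> (\<gamma> [^] e n) q2) q sequentially"
    using collapses_limitin[OF e(2) q2X] by blast
  then have qC: "q \<in> C" using limitin_in_closed[OF C(1) lim] fw C by auto
  then have "\<phi> \<gamma> q \<in> U" using \<gamma> by blast
  then have qU: "q \<in> U" using e by simp
  have qp: "q \<noteq> p" using qC C by auto
  have "p = r \<or> p = q" using per[of p 1] p \<gamma> by auto
  then have r: "r = p" using qp by auto
  have pow_q: "\<phi> (\<gamma> [^] (n::nat)) q = q" for n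
    using act_power_dvd[of \<gamma> q 1 n] e(4) \<gamma> rq by simp
  \<comment> \<open>If \<open>p\<close> and \<open>q\<close> were both globally fixed, each
    collapsing sequence would attract to whichever of them is not its repelling point, leaving at
    most two limit points.\<close>
  have "\<exists>h\<in>carrier G. \<phi> h q \<noteq> q"
  proof (rule ccontr)
    assume "\<not> ?thesis"
    then have fix_q: "\<And>h. h \<in> carrier G \<Longrightarrow> \<phi> h q = q" by blast
    have "limit_set G T \<phi> \<subseteq> {p, q}"
    proof
      fix b assume "b \<in> limit_set G T \<phi>"
      then obtain f r' where f: "distinct_seq G f" "collapses_to T \<phi> f r' b"
        by (auto simp: limit_set_def)
      then have "f n \<in> carrier G" for n by (auto simp: distinct_seq_def)
      then show "b \<in> {p, q}"
        using collapses_fixed_point[OF f(2), of p] collapses_fixed_point[OF f(2), of q] p rq fix_q qp by auto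
    qed
    then show False using limit_set_not_subset[of "{p,q}"] by (simp add: card_insert_if)
  qed
  then obtain h where h: "h \<in> carrier G" "\<phi> h q \<noteq> q" by blast
  define x where "x = \<phi> h q"
  have x: "x \<in> topspace T" "x \<noteq> q" using h rq by (auto simp: x_def)
  have "x \<noteq> p" using p h rq qp by (metis act_inj x_def)
  have ex: "\<exists>l. \<phi> (\<gamma> [^] (l::nat)) y \<in> C" if "y \<in> topspace T" "y \<noteq> p" for y
  proof -
    have "limitin T (\<lambda>n. \<phi> (\<gamma> [^] e n) y) q sequentially"
      using collapses_limitin[OF e(2)] that r by blast
    then have "\<forall>\<^sub>F n in sequentially. \<phi> (\<gamma> [^] e n) y \<in> U" using C(2) qU by (rule limitinD)
    then show ?thesis using C(3) by (auto simp: eventually_sequentially)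
  qed
  \<comment> \<open>Every \<open>b n\<close> maps \<open>q\<close> to \<open>\<phi> h q\<close>,
    although the sequence pushes all other points towards \<open>p\<close>.\<close>
  define b where "b n = h \<otimes> inv (\<gamma> [^] e n)" for n
  have bc: "b n \<in> carrier G" for n using h \<gamma> by (simp add: b_def)
  have de: "distinct_seq G (\<lambda>n. \<gamma> [^] e n)" using distinct_seq_powers \<gamma> ord e by blast
  have colb: "collapses_to T \<phi> (\<lambda>n. k \<otimes> b n) q p" if k: "k \<in> carrier G" for k
  proof -
    have "collapses_to T \<phi> (\<lambda>n. (k \<otimes> h) \<otimes> inv (\<gamma> [^] e n) \<otimes> \<one>) (\<phi> (inv \<one>) q) (\<phi> (k \<otimes> h) p)"
      using collapses_translate[OF collapses_inverse[OF e(2) de], of "k \<otimes> h" \<one>] h k \<gamma> r by auto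
    then show ?thesis using h k \<gamma> rq p by (simp add: b_def m_assoc)
  qed
  define y where "y n = \<phi> (b n) x" for n
  have y: "y n \<in> topspace T" "y n \<noteq> p" for n
    using bc x p \<open>x \<noteq> p\<close> act_inj[OF bc, of x p] by (auto simp: y_def)
  \<comment> \<open>The first time at which the powers of \<open>\<gamma>\<close> bring
    \<open>y n\<close> back into \<open>C\<close>.\<close>
  define l where "l n = (LEAST l. \<phi> (\<gamma> [^] (l::nat)) (y n) \<in> C)" for n
  have l: "\<phi> (\<gamma> [^] l n) (y n) \<in> C" "m < l n \<Longrightarrow> \<phi> (\<gamma> [^] m) (y n) \<notin> C" for n m
    unfolding l_def using LeastI_ex[OF ex[OF y]] not_less_Least by blast+
  \<comment> \<open>For fixed \<open>m\<close> the points
    \<open>\<phi> (\<gamma> [^] m) (y n)\<close> still tend to \<open>p\<close>, which the closed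
    set \<open>C\<close> misses. So each bounded return time is eventually excluded.\<close>
  have ltop: "filterlim l at_top sequentially"
    unfolding filterlim_at_top
  proof
    fix L :: nat
    have "\<forall>\<^sub>F n in sequentially. \<phi> (\<gamma> [^] m) (y n) \<notin> C" for m :: nat
    proof -
      have "limitin T (\<lambda>n. \<phi> (\<gamma> [^] m \<otimes> b n) x) p sequentially"
        using collapses_limitin[OF colb] \<gamma> x by simp
      then have "\<forall>\<^sub>F n in sequentially. \<phi> (\<gamma> [^] m \<otimes> b n) x \<in> topspace T - C"
        by (rule limitinD) (use C p in auto)
      then show ?thesis using bc \<gamma> x by (simp add: y_def composition_rule)
    qed
    then have "\<forall>\<^sub>F n in sequentially. \<forall>m\<in>{..<L}. \<phi> (\<gamma> [^] m) (y n) \<notin> C"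
      by (intro eventually_ball_finite) auto
    then show "\<forall>\<^sub>F n in sequentially. L \<le> l n"
      by eventually_elim (use l(1) in \<open>metis lessThan_iff not_less\<close>)
  qed
  obtain \<rho> :: "nat \<Rightarrow> nat" where \<rho>: "strict_mono \<rho>" "strict_mono (l \<circ> \<rho>)"
    using strict_mono_subseq_at_top[OF ltop] .
  define \<kappa> where "\<kappa> n = \<gamma> [^] l (\<rho> n) \<otimes> b (\<rho> n)" for n
  have \<kappa>c: "\<kappa> n \<in> carrier G" for n using \<gamma> bc by (simp add: \<kappa>_def)
  have \<kappa>q: "\<phi> (\<kappa> n) q = \<phi> (\<gamma> [^] l (\<rho> n)) x" for n
  proof -
    have "\<phi> (inv (\<gamma> [^] e m)) q = q" for m
      using pow_q[of "e m"] \<gamma> rq by (metis act_inv_cancel(1) nat_pow_closed)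
    then show ?thesis using \<gamma> h rq by (simp add: \<kappa>_def b_def composition_rule x_def)
  qed
  have \<kappa>x: "\<phi> (\<kappa> n) x \<in> C" for n
    using l(1)[of "\<rho> n"] \<gamma> bc x by (simp add: \<kappa>_def y_def composition_rule)
  \<comment> \<open>Minimality of the return time, one step earlier. The condition
    \<open>n > 0\<close> makes that time positive, as the times increase strictly.\<close>
  have \<kappa>x': "\<phi> (inv \<gamma>) (\<phi> (\<kappa> n) x) \<notin> C" if "n > 0" for n
  proof -
    have "l (\<rho> 0) < l (\<rho> n)" using \<rho>(2) that by (auto simp: strict_mono_def)
    then obtain m where m: "l (\<rho> n) = Suc m" using not0_implies_Suc by (metis not_less_zero)
    have "\<phi> (\<kappa> n) x = \<phi> \<gamma> (\<phi> (\<gamma> [^] m) (y (\<rho> n)))"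
      using m nat_pow_Suc2[OF \<gamma>(1), of m] \<gamma> bc x by (simp add: \<kappa>_def y_def composition_rule)
    then show ?thesis using l(2)[of m "\<rho> n"] m \<gamma> y by simp
  qed
  have inj\<kappa>: "\<kappa> i \<noteq> \<kappa> j" if "i < j" for i j
  proof
    assume "\<kappa> i = \<kappa> j"
    then have eq: "\<phi> (\<gamma> [^] l (\<rho> i)) x = \<phi> (\<gamma> [^] l (\<rho> j)) x" using \<kappa>q by metis
    have "l (\<rho> i) < l (\<rho> j)" using \<rho>(2) that by (auto simp: strict_mono_def)
    then obtain d where d: "l (\<rho> j) = l (\<rho> i) + d" "d > 0" using less_imp_add_positive by metis
    have "\<phi> (\<gamma> [^] l (\<rho> j)) x = \<phi> (\<gamma> [^] l (\<rho> i)) (\<phi> (\<gamma> [^] d) x)"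
      using d \<gamma> x by (simp add: composition_rule flip: nat_pow_mult)
    then have "\<phi> (\<gamma> [^] d) x = x"
      using eq act_inj[of "\<gamma> [^] l (\<rho> i)" x "\<phi> (\<gamma> [^] d) x"] \<gamma> x by simp
    then show False using per[OF x(1) d(2)] r x \<open>x \<noteq> p\<close> by blast
  qed
  then have "inj \<kappa>" by (metis injI linorder_neqE_nat)
  then have d\<kappa>: "distinct_seq G \<kappa>" using \<kappa>c by (auto simp: distinct_seq_def)
  obtain \<tau> r' a' where \<tau>: "strict_mono (\<tau> :: nat \<Rightarrow> nat)" "collapses_to T \<phi> (\<kappa> \<circ> \<tau>) r' a'"
    using convergence_subseq[OF d\<kappa>] .
  have sl: "strict_mono (\<lambda>n. l (\<rho> (\<tau> n)))" using \<rho> \<tau> by (simp add: strict_mono_def)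
  obtain \<mu> r2 q' where \<mu>: "strict_mono (\<mu> :: nat \<Rightarrow> nat)"
      "collapses_to T \<phi> (\<lambda>n. \<gamma> [^] l (\<rho> (\<tau> (\<mu> n)))) r2 q'" "\<phi> \<gamma> r2 = r2" "\<phi> \<gamma> q' = q'"
    using powers_collapse[OF \<gamma>(1) ord sl] .
  have r2X: "r2 \<in> topspace T" "q' \<in> topspace T" using \<mu> by (auto simp: collapses_to_def)
  have "x \<noteq> r2" using per[of r2 1] \<mu> \<gamma> r2X x \<open>x \<noteq> p\<close> r by auto
  then have limx: "limitin T (\<lambda>n. \<phi> (\<gamma> [^] l (\<rho> (\<tau> (\<mu> n)))) x) q' sequentially"
    using collapses_limitin[OF \<mu>(2) x(1)] by blast
  obtain l0 where l0: "\<phi> (\<gamma> [^] (l0::nat)) x \<in> C" using ex x \<open>x \<noteq> p\<close> by blast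
  have "\<phi> (\<gamma> [^] m) x \<in> C" if "m \<ge> l0" for m :: nat
  proof -
    define d where "d = m - l0"
    then have d: "m = d + l0" using that by simp
    have "\<phi> (\<gamma> [^] m) x = \<phi> (\<gamma> [^] d) (\<phi> (\<gamma> [^] l0) x)"
      using d \<gamma> x by (simp add: composition_rule flip: nat_pow_mult)
    then show ?thesis using fw l0 by simp
  qed
  moreover have "n \<le> l (\<rho> (\<tau> (\<mu> n)))" for n
  proof -
    have "strict_mono (\<lambda>n. l (\<rho> (\<tau> (\<mu> n))))" using sl \<mu> by (simp add: strict_mono_def)
    then show ?thesis using seq_suble by blast
  qed
  ultimately have "\<forall>\<^sub>F n in sequentially. \<phi> (\<gamma> [^] l (\<rho> (\<tau> (\<mu> n)))) x \<in> C"
    unfolding eventually_sequentially by (meson order_trans)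
  then have "q' \<in> C" using limitin_in_closed[OF C(1) limx] by blast
  \<comment> \<open>\<open>q'\<close> is a fixed point of \<open>\<gamma>\<close> lying in
    \<open>C\<close>, hence different from the repelling point \<open>p\<close>.\<close>
  then have q': "q' = q" using per[of q' 1] \<mu> \<gamma> r2X r C by auto
  define k where "k = \<kappa> \<circ> \<tau> \<circ> \<mu>"
  have k: "collapses_to T \<phi> k r' a'" using collapses_subseq[OF \<tau>(2) \<mu>(1)] by (simp add: k_def)
  have kq: "limitin T (\<lambda>n. \<phi> (k n) q) q sequentially" using limx q' by (simp add: k_def \<kappa>q)
  have kC: "\<phi> (k n) x \<in> C" for n using \<kappa>x by (simp add: k_def)
  have kp: "r' \<noteq> p \<Longrightarrow> a' = p"
    using collapses_fixed_point[OF k p(1)] p(2) \<kappa>c by (auto simp: k_def)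
  \<comment> \<open>Under \<open>k\<close>, \<open>p\<close> stays put, \<open>q\<close> tends to
    \<open>q\<close> and \<open>x\<close> stays in \<open>C\<close>. A repelling point
    \<open>q\<close> would send \<open>x\<close> to \<open>p\<close>, outside \<open>C\<close>.
    Otherwise the poles are \<open>p\<close> and \<open>q\<close>, so \<open>x\<close> tends to
    \<open>q\<close> and even its images one \<open>\<gamma>\<close>-step earlier end up in
    \<open>U\<close>, against minimality.\<close>
  show False
  proof (cases "r' = q")
    case True
    then have "a' = p" "x \<noteq> r'" using kp qp x by auto
    then have "limitin T (\<lambda>n. \<phi> (k n) x) p sequentially" using collapses_limitin[OF k x(1)] by simp
    then show False using limitin_in_closed[OF C(1), of "\<lambda>n. \<phi> (k n) x" p] kC C by simp
  next
    case False
    then have "a' = q" using collapses_limitin[OF k rq(2)] kq limitin_unique by metis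
    then have "r' = p" using kp qp by auto
    then have "limitin T (\<lambda>n. \<phi> (k n) x) q sequentially"
      using collapses_limitin[OF k x(1)] \<open>x \<noteq> p\<close> \<open>a' = q\<close> by simp
    then have "limitin T (\<phi> (inv \<gamma>) \<circ> (\<lambda>n. \<phi> (k n) x)) (\<phi> (inv \<gamma>) q) sequentially"
      using continuous_map_limit[OF act_continuous[of "inv \<gamma>"]] \<gamma> by simp
    moreover have "\<phi> (inv \<gamma>) q = q" using act_inv_cancel(1)[OF \<gamma>(1) rq(2)] e(4) by simp
    ultimately have "limitin T (\<phi> (inv \<gamma>) \<circ> (\<lambda>n. \<phi> (k n) x)) q sequentially" by simp
    then have "\<forall>\<^sub>F n in sequentially. (\<phi> (inv \<gamma>) \<circ> (\<lambda>n. \<phi> (k n) x)) n \<in> U"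
      using C(2) qU by (rule limitinD)
    then obtain N where N: "\<And>n. n \<ge> N \<Longrightarrow> \<phi> (inv \<gamma>) (\<phi> (k n) x) \<in> U"
      by (auto simp: eventually_sequentially)
    have "strict_mono (\<lambda>n. \<tau> (\<mu> n))" using \<tau> \<mu> by (simp add: strict_mono_def)
    then have "Suc N \<le> \<tau> (\<mu> (Suc N))" using seq_suble by blast
    then have "0 < \<tau> (\<mu> (Suc N))" by simp
    then have "\<phi> (inv \<gamma>) (\<phi> (k (Suc N)) x) \<notin> C" using \<kappa>x' by (simp add: k_def)
    moreover have "\<phi> (inv \<gamma>) (\<phi> (k (Suc N)) x) \<in> C" using N[of "Suc N"] C(3) by auto
    ultimately show False by blast
  qed
qed

text \<open>In a finite orbit convergence means being eventually constant, so injectivity lets at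
  most one orbit point differ from the repelling point of any collapsing sequence. The orbit thus
  has at most two points. With two it would contain the whole limit set; with one it would be a
  global fixed point.\<close>

lemma infinite_orbit:
  assumes x: "x \<in> topspace T"
  shows "infinite ((\<lambda>g. \<phi> g x) ` carrier G)" (is "infinite ?F")
proof
  assume fin: "finite ?F"
  have FX: "?F \<subseteq> topspace T" using x by auto
  have inv: "\<phi> g y \<in> ?F" if "g \<in> carrier G" "y \<in> ?F" for g y
  proof -
    obtain g' where g': "g' \<in> carrier G" "y = \<phi> g' x" using \<open>y \<in> ?F\<close> by blast
    then have "\<phi> g y = \<phi> (g \<otimes> g') x" using that x composition_rule by simp
    then show ?thesis using g' that by blast
  qed
  have xF: "x \<in> ?F" using x by (auto simp: image_iff intro!: bexI[of _ \<one>])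
  have key: "card (?F - {r}) \<le> 1 \<and> (?F - {r} \<noteq> {} \<longrightarrow> a \<in> ?F)"
    if col: "collapses_to T \<phi> g r a" and g: "distinct_seq G g" for g r a
  proof -
    have gc: "g n \<in> carrier G" for n using g by (auto simp: distinct_seq_def)
    have lim: "limitin T (\<lambda>n. \<phi> (g n) y) a sequentially" if "y \<in> ?F - {r}" for y
      using collapses_limitin[OF col, of y] that FX by auto
    have aF: "a \<in> ?F" if "y \<in> ?F - {r}" for y
      using limitin_in_closed[OF closedin_finite[OF fin FX] lim[OF that]] inv gc that by auto
    have ev: "\<forall>\<^sub>F n in sequentially. \<phi> (g n) y = a" if y: "y \<in> ?F - {r}" for y
    proof -
      have "closedin T (?F - {a})" using closedin_finite fin FX by (meson Diff_subset finite_Diff subset_trans)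
      then have "openin T (topspace T - (?F - {a}))" by blast
      then have "\<forall>\<^sub>F n in sequentially. \<phi> (g n) y \<in> topspace T - (?F - {a})"
        using limitinD[OF lim[OF y]] aF[OF y] FX by blast
      then show ?thesis
        by eventually_elim (use inv gc y in blast)
    qed
    have "y = y'" if "y \<in> ?F - {r}" "y' \<in> ?F - {r}" for y y'
    proof -
      have "\<forall>\<^sub>F n in sequentially. \<phi> (g n) y = a \<and> \<phi> (g n) y' = a"
        using ev[OF that(1)] ev[OF that(2)] by (rule eventually_conj)
      then obtain N where "\<forall>n\<ge>N. \<phi> (g n) y = a \<and> \<phi> (g n) y' = a"
        unfolding eventually_sequentially by blast
      then have "\<phi> (g N) y = \<phi> (g N) y'" by simp
      then show ?thesis using act_inj[OF gc] that FX by blast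
    qed
    then have "card (?F - {r}) \<le> 1" using fin by (metis card_le_Suc0_iff_eq One_nat_def finite_Diff)
    then show ?thesis using aF by blast
  qed
  obtain b where b: "b \<in> limit_set G T \<phi>" using other_limit_point by blast
  then obtain g r where gr: "distinct_seq G g" "collapses_to T \<phi> g r b" by (auto simp: limit_set_def)
  have "card ?F \<le> 2" using key[OF gr(2,1), THEN conjunct1] unfolding card_Diff_singleton_if
    by (simp split: if_splits)
  show False
  proof (cases "\<exists>y\<in>?F. y \<noteq> x")
    case True
    then have "?F - {r} \<noteq> {}" for r using xF by blast
    then have "limit_set G T \<phi> \<subseteq> ?F" using key by (auto simp: limit_set_def)
    then show False using limit_set_not_subset fin \<open>card ?F \<le> 2\<close> by blast
  next
    case False
    then show False using no_global_fixed_point[OF x] by blast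
  qed
qed

end


section \<open>Ping-pong\<close>

text \<open>Values of nonempty reduced words: \<open>\<iota>\<close> is formal inversion of letters,
  and the letter argument records the leftmost letter of the word.\<close>

inductive reduced_product ::
  "('g, 'b) monoid_scheme \<Rightarrow> 'l set \<Rightarrow> ('l \<Rightarrow> 'l) \<Rightarrow> ('l \<Rightarrow> 'g) \<Rightarrow> 'l \<Rightarrow> 'g \<Rightarrow> bool"
  for G L \<iota> w where
  letter: "l \<in> L \<Longrightarrow> reduced_product G L \<iota> w l (w l)"
| mult: "reduced_product G L \<iota> w l' h \<Longrightarrow> l \<in> L \<Longrightarrow> l \<noteq> \<iota> l' \<Longrightarrow>
    reduced_product G L \<iota> w l (w l \<otimes>\<^bsub>G\<^esub> h)"

context group
begin

lemma reduced_product_carrier: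
  assumes "reduced_product G L \<iota> w l h" "\<And>l. l \<in> L \<Longrightarrow> w l \<in> carrier G"
  shows "h \<in> carrier G" "l \<in> L"
  using assms by (induction rule: reduced_product.induct) auto

text \<open>The identity together with all reduced products is stable under left multiplication by
  letters, hence by the generated subgroup. Apply this stability to the identity.\<close>

lemma generate_imp_reduced_product:
  assumes w: "\<And>l. l \<in> L \<Longrightarrow> w l \<in> carrier G"
    and \<iota>: "\<And>l. l \<in> L \<Longrightarrow> \<iota> l \<in> L" "\<And>l. l \<in> L \<Longrightarrow> \<iota> (\<iota> l) = l"
    and w_\<iota>: "\<And>l. l \<in> L \<Longrightarrow> w (\<iota> l) = inv (w l)"
    and h: "h \<in> generate G (w ` L)" "h \<noteq> \<one>"
  obtains l where "reduced_product G L \<iota> w l h"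
proof -
  define N where "N = insert \<one> {h. \<exists>l. reduced_product G L \<iota> w l h}"
  have N: "N \<subseteq> carrier G" using reduced_product_carrier(1)[OF _ w] by (auto simp: N_def)
  have step: "w l \<otimes> h \<in> N" if l: "l \<in> L" and h: "h \<in> N" for l h
  proof (cases "h = \<one>")
    case True
    then show ?thesis using l w by (auto simp: N_def intro: reduced_product.letter)
  next
    case False
    then obtain l' where l': "reduced_product G L \<iota> w l' h" using h by (auto simp: N_def)
    then have l'L: "l' \<in> L" using reduced_product_carrier w by metis
    show ?thesis
    proof (cases "l = \<iota> l'")
      case False
      then show ?thesis using l l' by (auto simp: N_def intro: reduced_product.mult)
    next
      \<comment> \<open>The new letter cancels the leftmost one; what remains is the identity or a
        shorter reduced product.\<close>
      case True
      then have inv: "w l = inv (w l')" using w_\<iota> l'L by simp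
      from l' show ?thesis
      proof cases
        case letter
        then show ?thesis using inv w l'L by (simp add: N_def)
      next
        case (mult l'' h'')
        then have "h'' \<in> carrier G" using reduced_product_carrier w by metis
        then have "w l \<otimes> h = h''" using mult inv w l'L by (simp flip: m_assoc)
        then show ?thesis using mult by (auto simp: N_def)
      qed
    qed
  qed
  from h(1) have "\<forall>h'\<in>N. h \<otimes> h' \<in> N"
  proof (induction rule: generate.induct)
    case one
    then show ?case using N by auto
  next
    case (incl h)
    then show ?case using step by blast
  next
    case (inv h)
    then obtain l where "l \<in> L" "h = w l" by blast
    then show ?case using step[of "\<iota> l"] \<iota> w_\<iota> by simp
  next
    case (eng h1 h2)
    have "h1 \<in> carrier G" "h2 \<in> carrier G"
      using eng.hyps generate_in_carrier[of "w ` L"] w by auto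
    then show ?case using eng.IH N m_assoc by (metis subsetD)
  qed
  moreover have "h \<in> carrier G" using h generate_in_carrier[of "w ` L"] w by auto
  ultimately have "h \<in> N" by (auto simp: N_def dest: bspec[of _ _ \<one>])
  then show thesis using h(2) that by (auto simp: N_def)
qed

end

text \<open>Induction on the reduced word: \<open>p\<close> lies in no region, so the rightmost
  letter \<open>l\<close> sends it into \<open>D l\<close>. Each further letter sees a point outside
  the region of its inverse and moves it into its own.\<close>

lemma (in group_action) ping_pong:
  assumes w: "\<And>l. l \<in> L \<Longrightarrow> w l \<in> carrier G"
    and \<iota>: "\<And>l. l \<in> L \<Longrightarrow> \<iota> l \<in> L" "\<And>l. l \<in> L \<Longrightarrow> \<iota> (\<iota> l) = l"
    and w_\<iota>: "\<And>l. l \<in> L \<Longrightarrow> w (\<iota> l) = inv (w l)"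
    and D: "\<And>l. l \<in> L \<Longrightarrow> D l \<subseteq> E" "\<And>l l'. l \<in> L \<Longrightarrow> l' \<in> L \<Longrightarrow> l \<noteq> l' \<Longrightarrow> D l \<inter> D l' = {}"
    and maps: "\<And>l x. l \<in> L \<Longrightarrow> x \<in> E \<Longrightarrow> x \<notin> D (\<iota> l) \<Longrightarrow> \<phi> (w l) x \<in> D l"
    and p: "p \<in> E" "\<And>l. l \<in> L \<Longrightarrow> p \<notin> D l"
    and h: "h \<in> generate G (w ` L)" "h \<noteq> \<one>"
  shows "\<exists>l\<in>L. \<phi> h p \<in> D l"
proof -
  interpret group G using group_hom group_hom.axioms(1) by blast
  obtain l where "reduced_product G L \<iota> w l h"
    using generate_imp_reduced_product[OF w \<iota> w_\<iota> h] .
  then have "l \<in> L \<and> h \<in> carrier G \<and> \<phi> h p \<in> D l"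
  proof (induction rule: reduced_product.induct)
    case (letter l)
    then show ?case using w[of l] maps[of l p] p(1) p(2)[of "\<iota> l"] \<iota>(1)[of l] by simp
  next
    case (mult l' h l)
    then have IH: "l' \<in> L" "h \<in> carrier G" "\<phi> h p \<in> D l'" by auto
    \<comment> \<open>Reducedness says precisely that the current region is not the one repelled by
      the next letter.\<close>
    have "\<iota> l \<noteq> l'" using \<iota>(2)[OF mult.hyps(2)] mult.hyps(3) by auto
    then have "\<phi> h p \<notin> D (\<iota> l)"
      using D(2)[OF \<iota>(1)[OF mult.hyps(2)] IH(1)] IH(3) by auto
    then have "\<phi> (w l) (\<phi> h p) \<in> D l"
      using maps[OF mult.hyps(2), of "\<phi> h p"] D(1)[OF IH(1)] IH(3) by auto
    then show ?case using composition_rule[OF p(1)] IH w mult.hyps by simp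
  qed
  then show ?thesis by blast
qed

section \<open>The ping-pong configuration\<close>

context convergence_group
begin

text \<open>Left translation moves the attracting point off the repelling one; a far element of the
  translated sequence then contracts a region strictly.\<close>

lemma infinite_order_element:
  obtains g r a t where "distinct_seq G g" "collapses_to T \<phi> g r a" "t \<in> carrier G" "ord t = 0"
proof -
  obtain b where "b \<in> limit_set G T \<phi>" using other_limit_point by blast
  then obtain g r where g: "distinct_seq G g" "collapses_to T \<phi> g r b" by (auto simp: limit_set_def)
  have X: "r \<in> topspace T" "b \<in> topspace T" using g by (auto simp: collapses_to_def)
  obtain h where h: "h \<in> carrier G" "\<phi> h b \<noteq> r"
    using infinite_orbit[OF X(2)] finite_subset[of "(\<lambda>g. \<phi> g b) ` carrier G" "{r}"] by blast
  define f where "f n = h \<otimes> g n \<otimes> \<one>" for n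
  have gc: "range g \<subseteq> carrier G" using g by (simp add: distinct_seq_def)
  have f: "collapses_to T \<phi> f r (\<phi> h b)"
    using collapses_translate[OF g(2) gc h(1) one_closed] X unfolding f_def by simp
  obtain c where c: "c \<in> topspace T" "c \<noteq> r" "c \<noteq> \<phi> h b" using other_point .
  obtain C U where C: "closedin T C" "openin T U" "U \<subseteq> C" "r \<notin> C" "c \<in> C - U"
    "\<forall>\<^sub>F n in sequentially. \<phi> (f n) ` C \<subseteq> U"
    using collapses_attracting_region[OF f h(2)[symmetric] c] .
  then obtain n where n: "\<phi> (f n) ` C \<subseteq> U" by (auto simp: eventually_sequentially)
  have fc: "f n \<in> carrier G" using gc h by (auto simp: f_def)
  have "\<phi> (f n) ` C \<subset> C" using n C by blast
  then have "ord (f n) = 0" using ord_eq_0_if_contracts[OF fc closedin_subset[OF C(1)]] by blast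
  then show thesis using that g fc by blast
qed

text \<open>\<open>Vy\<close> and \<open>Vz\<close> surround translates \<open>y\<close> and
  \<open>z\<close> of the poles of one collapsing sequence. Infinite orbits let \<open>y\<close> and
  \<open>z\<close> dodge finitely many coincidences, after which small neighbourhoods satisfy all
  the disjointness demands.\<close>

lemma far_element:
  assumes S: "finite S" "S \<subseteq> carrier G"
  obtains t p g Vy Vz where "t \<in> carrier G" "ord t = 0" "p \<in> topspace T" "\<phi> t p = p"
    "g \<in> carrier G" "Vy \<subseteq> topspace T" "Vz \<subseteq> topspace T"
    "\<And>c x. c = g \<or> (\<exists>s\<in>S. c = g \<otimes> s \<otimes> g) \<Longrightarrow> x \<in> topspace T \<Longrightarrow> x \<notin> Vz \<Longrightarrow> \<phi> c x \<in> Vy"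
    "\<And>m. m < M \<Longrightarrow> p \<notin> \<phi> (t [^] m) ` Vy \<and> p \<notin> \<phi> (t [^] m) ` Vz"
    "\<And>m m'. m < M \<Longrightarrow> m' < M \<Longrightarrow> \<phi> (t [^] m) ` Vy \<inter> \<phi> (t [^] m') ` Vz = {}"
    "\<And>m m'. m < M \<Longrightarrow> m' < M \<Longrightarrow> m \<noteq> m' \<Longrightarrow> \<phi> (t [^] m) ` Vy \<inter> \<phi> (t [^] m') ` Vy = {}"
    "\<And>m m'. m < M \<Longrightarrow> m' < M \<Longrightarrow> m \<noteq> m' \<Longrightarrow> \<phi> (t [^] m) ` Vz \<inter> \<phi> (t [^] (m' :: nat)) ` Vz = {}"
proof -
  obtain g0 r0 a0 t where g0: "distinct_seq G g0" "collapses_to T \<phi> g0 r0 a0"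
    and t: "t \<in> carrier G" "ord t = 0"
    using infinite_order_element .
  have g0c: "range g0 \<subseteq> carrier G" using g0 by (simp add: distinct_seq_def)
  have X0: "r0 \<in> topspace T" "a0 \<in> topspace T" using g0 by (auto simp: collapses_to_def)
  obtain e r p where e: "collapses_to T \<phi> (\<lambda>n. t [^] (e n :: nat)) r p" "\<phi> t p = p"
    and per: "\<And>x m. x \<in> topspace T \<Longrightarrow> 0 < m \<Longrightarrow> \<phi> (t [^] (m::nat)) x = x \<Longrightarrow> x = r \<or> x = p"
    using periodic_points[OF t] by metis
  have pX: "p \<in> topspace T" using e by (auto simp: collapses_to_def)
  have pw: "\<phi> (t [^] (m::nat)) p = p" for m using act_power_dvd[of t p 1 m] e t pX by simp
  have inf: "\<exists>k\<in>carrier G. \<phi> k b \<notin> B" if "b \<in> topspace T" "finite B" for b B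
    using infinite_orbit[OF that(1)] finite_subset[OF _ that(2), of "(\<lambda>g. \<phi> g b) ` carrier G"] by blast
  obtain h where h: "h \<in> carrier G" "\<phi> h a0 \<notin> {r, p}" using inf[OF X0(2), of "{r,p}"] by blast
  define y where "y = \<phi> h a0"
  have y: "y \<in> topspace T" "y \<noteq> r" "y \<noteq> p" using h X0 by (auto simp: y_def)
  \<comment> \<open>What \<open>z\<close> must avoid: the possible periodic points of
    \<open>t\<close>, equality of some \<open>t [^] m'\<close> translate of \<open>z\<close> with a
    \<open>t [^] m\<close> translate of \<open>y\<close>, and the points
    \<open>\<phi> s y\<close>.\<close>
  define B where "B = {r, p} \<union> (\<lambda>(m,m'). \<phi> (inv (t [^] m')) (\<phi> (t [^] m) y)) ` ({..<M} \<times> {..<M}) \<union> (\<lambda>s. \<phi> s y) ` S"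
  have "finite B" using S by (simp add: B_def)
  then obtain k where k: "k \<in> carrier G" "\<phi> k r0 \<notin> B" using inf[OF X0(1)] by blast
  define z where "z = \<phi> k r0"
  have zB: "z \<in> topspace T" "z \<notin> B" using k X0 by (auto simp: z_def)
  then have z: "z \<in> topspace T" "z \<noteq> r" "z \<noteq> p" by (auto simp: B_def)
  define f where "f n = h \<otimes> g0 n \<otimes> inv k" for n
  have f: "collapses_to T \<phi> f z y"
    using collapses_translate[OF g0(2) g0c h(1), of "inv k"] k unfolding f_def y_def z_def by simp
  have fc: "f n \<in> carrier G" for n using g0c h k by (auto simp: f_def)
  have free: "\<phi> (t [^] m) x \<noteq> \<phi> (t [^] m') x"
    if x: "x \<in> topspace T" "x \<noteq> r" "x \<noteq> p" and m: "m < m'" for x and m m' :: nat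
  proof
    assume eq: "\<phi> (t [^] m) x = \<phi> (t [^] m') x"
    obtain d where d: "m' = m + d" "0 < d" using less_imp_add_positive[OF m] by auto
    have "\<phi> (t [^] m') x = \<phi> (t [^] m) (\<phi> (t [^] d) x)"
      using d t x by (simp add: composition_rule flip: nat_pow_mult)
    then have "\<phi> (t [^] d) x = x" using eq act_inj[of "t [^] m" x "\<phi> (t [^] d) x"] t x by simp
    then show False using per[OF x(1) d(2)] x by blast
  qed
  define Q where "Q = insert p ((\<lambda>m. \<phi> (t [^] m) y) ` {..<M} \<union> (\<lambda>m. \<phi> (t [^] m) z) ` {..<M})"
  have "finite Q" "Q \<subseteq> topspace T" using t y z pX by (auto simp: Q_def)
  then obtain W where W: "\<And>q. q \<in> Q \<Longrightarrow> openin T (W q) \<and> q \<in> W q"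
    "\<And>q q'. q \<in> Q \<Longrightarrow> q' \<in> Q \<Longrightarrow> q \<noteq> q' \<Longrightarrow> W q \<inter> W q' = {}"
    using finite_points_disjoint_nbhds[OF Hausdorff] by metis
  \<comment> \<open>A neighbourhood of \<open>x\<close> whose first \<open>M\<close> translates
    under \<open>t\<close> land in the separated sets \<open>W\<close>. Intersecting with the space
    covers \<open>M = 0\<close>, where the indexed intersection is everything.\<close>
  define V where "V x = (\<Inter>m<M. {v \<in> topspace T. \<phi> (t [^] m) v \<in> W (\<phi> (t [^] m) x)}) \<inter> topspace T" for x
  have Vsub: "V x \<subseteq> topspace T" for x by (auto simp: V_def)
  have VW: "\<phi> (t [^] m) ` V x \<subseteq> W (\<phi> (t [^] m) x)" if "m < M" for m x
    using that by (auto simp: V_def)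
  have V: "openin T (V x)" "x \<in> V x" if "x \<in> topspace T" "\<And>m. m < M \<Longrightarrow> \<phi> (t [^] m) x \<in> Q" for x
  proof -
    show "openin T (V x)" unfolding V_def
      using W(1) that openin_act_preimage t by (intro openin_INT) auto
    show "x \<in> V x" using W(1) that by (auto simp: V_def)
  qed
  have Vy: "openin T (V y)" "y \<in> V y" and Vz: "openin T (V z)" "z \<in> V z"
    using V y z by (auto simp: Q_def)
  have "compactin T {z}" "compactin T ((\<lambda>s. \<phi> s y) ` S)"
    using S y z by (auto intro!: finite_imp_compactin)
  moreover have "disjnt {z} ((\<lambda>s. \<phi> s y) ` S)" using zB by (auto simp: B_def disjnt_def)
  ultimately obtain Oz Os where O: "openin T Oz" "openin T Os" "{z} \<subseteq> Oz" "(\<lambda>s. \<phi> s y) ` S \<subseteq> Os" "disjnt Oz Os"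
    using Hausdorff unfolding Hausdorff_space_compact_sets by metis
  define Vz' where "Vz' = V z \<inter> Oz"
  \<comment> \<open>Points of \<open>Vy'\<close> are sent by each \<open>s\<close> into
    \<open>Os\<close>, hence off \<open>Vz'\<close>. This lets the second \<open>g\<close> in
    \<open>g s g\<close> attract again.\<close>
  define Vy' where "Vy' = V y \<inter> ((\<Inter>s\<in>S. {v \<in> topspace T. \<phi> s v \<in> Os}) \<inter> topspace T)"
  have "openin T ((\<Inter>s\<in>S. {v \<in> topspace T. \<phi> s v \<in> Os}) \<inter> topspace T)"
    using S O openin_act_preimage by (intro openin_INT) auto
  then have oVy': "openin T Vy'" "y \<in> Vy'" using Vy O y by (auto simp: Vy'_def)
  have oVz': "openin T Vz'" "z \<in> Vz'" using Vz O by (auto simp: Vz'_def)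
  have "compactin T (topspace T - Vz')"
    using oVz' compact closedin_compact_space by blast
  then have "\<forall>\<^sub>F n in sequentially. \<phi> (f n) ` (topspace T - Vz') \<subseteq> Vy'"
    using f oVy' oVz' unfolding collapses_to_def by auto
  then obtain n where n: "\<phi> (f n) ` (topspace T - Vz') \<subseteq> Vy'" by (auto simp: eventually_sequentially)
  show thesis
  proof (rule that[of t p "f n" "V y" Vz'])
    show "t \<in> carrier G" "ord t = 0" "p \<in> topspace T" "\<phi> t p = p" "f n \<in> carrier G"
      by fact+
    show "V y \<subseteq> topspace T" "Vz' \<subseteq> topspace T" using Vsub by (auto simp: Vz'_def)
    show "\<phi> c x \<in> V y" if c: "c = f n \<or> (\<exists>s\<in>S. c = f n \<otimes> s \<otimes> f n)" and x: "x \<in> topspace T" "x \<notin> Vz'" for c x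
    proof -
      have fx: "\<phi> (f n) x \<in> Vy'" using n x by blast
      have "\<phi> (f n \<otimes> s \<otimes> f n) x \<in> V y" if s: "s \<in> S" for s
      proof -
        have "\<phi> s (\<phi> (f n) x) \<in> Os" using fx s by (auto simp: Vy'_def)
        then have "\<phi> s (\<phi> (f n) x) \<in> topspace T - Vz'"
          using O fx s S(2) fc x by (auto simp: Vz'_def disjnt_def)
        then have "\<phi> (f n) (\<phi> s (\<phi> (f n) x)) \<in> V y" using n by (auto simp: Vy'_def)
        then show ?thesis using s S fc x by (auto simp: composition_rule subset_iff)
      qed
      then show ?thesis using c fx by (auto simp: Vy'_def)
    qed
    have disj: "A \<inter> A' = {}" if "A \<subseteq> W q" "A' \<subseteq> W q'" "q \<in> Q" "q' \<in> Q" "q \<noteq> q'" for A A' q q'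
      using W(2)[OF that(3-5)] that by blast
    have yQ: "\<phi> (t [^] m) y \<in> Q" and zQ: "\<phi> (t [^] m) z \<in> Q" if "m < M" for m
      using that by (auto simp: Q_def)
    have Vz'W: "\<phi> (t [^] m) ` Vz' \<subseteq> W (\<phi> (t [^] m) z)" if "m < M" for m
      using VW[OF that, of z] by (auto simp: Vz'_def)
    have pQ: "p \<in> Q" "p \<in> W p" using W(1) by (auto simp: Q_def)
    have ne_p: "\<phi> (t [^] (m::nat)) x \<noteq> p" if "x \<in> topspace T" "x \<noteq> p" for m x
      using act_inj[of "t [^] m" x p] pw[of m] that pX t by simp
    show "p \<notin> \<phi> (t [^] m) ` V y \<and> p \<notin> \<phi> (t [^] m) ` Vz'" if m: "m < M" for m
      using disj[OF VW[OF m] subset_refl yQ[OF m] pQ(1) ne_p[OF y(1,3)]]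
        disj[OF Vz'W[OF m] subset_refl zQ[OF m] pQ(1) ne_p[OF z(1,3)]] pQ(2) by blast
    show "\<phi> (t [^] m) ` V y \<inter> \<phi> (t [^] m') ` Vz' = {}" if m: "m < M" "m' < M" for m m'
    proof (rule disj[OF VW[OF m(1)] Vz'W[OF m(2)] yQ[OF m(1)] zQ[OF m(2)]])
      have "z \<noteq> \<phi> (inv (t [^] m')) (\<phi> (t [^] m) y)" using zB m by (auto simp: B_def)
      then show "\<phi> (t [^] m) y \<noteq> \<phi> (t [^] m') z" using t z by auto
    qed
    show "\<phi> (t [^] m) ` V y \<inter> \<phi> (t [^] m') ` V y = {}" if m: "m < M" "m' < M" "m \<noteq> m'" for m m'
      by (rule disj[OF VW[OF m(1)] VW[OF m(2)] yQ[OF m(1)] yQ[OF m(2)]])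
        (use free[OF y, of m m'] free[OF y, of m' m] m in \<open>auto simp: neq_iff\<close>)
    show "\<phi> (t [^] m) ` Vz' \<inter> \<phi> (t [^] m') ` Vz' = {}" if m: "m < M" "m' < M" "m \<noteq> m'" for m m'
      by (rule disj[OF Vz'W[OF m(1)] Vz'W[OF m(2)] zQ[OF m(1)] zQ[OF m(2)]])
        (use free[OF z, of m m'] free[OF z, of m' m] m in \<open>auto simp: neq_iff\<close>)
  qed
qed


text \<open>Powers of \<open>t\<close> fix \<open>p\<close>, while nontrivial elements of the
  generated group send \<open>p\<close> into regions that miss it. The pattern \<open>c\<close> is
  quantified after \<open>t\<close> and \<open>g\<close>, so it can be chosen later in
  blocks.\<close>

lemma conjugates_avoid_powers:
  assumes S: "finite S" "S \<subseteq> carrier G"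
  obtains t g where "t \<in> carrier G" "g \<in> carrier G"
    "\<And>c j. (\<And>m::nat. c m = g \<or> (\<exists>s\<in>S. c m = g \<otimes> s \<otimes> g)) \<Longrightarrow> 0 < j \<Longrightarrow>
       t [^] (j::nat) \<notin> generate G ((\<lambda>m. t [^] m \<otimes> c m \<otimes> inv (t [^] m)) ` {..<M})"
proof -
  obtain t p g Vy Vz where t: "t \<in> carrier G" "ord t = 0" and p: "p \<in> topspace T" "\<phi> t p = p"
    and g: "g \<in> carrier G" and V: "Vy \<subseteq> topspace T" "Vz \<subseteq> topspace T"
    and maps: "\<And>c x. c = g \<or> (\<exists>s\<in>S. c = g \<otimes> s \<otimes> g) \<Longrightarrow> x \<in> topspace T \<Longrightarrow> x \<notin> Vz \<Longrightarrow> \<phi> c x \<in> Vy"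
    and pV: "\<And>m. m < M \<Longrightarrow> p \<notin> \<phi> (t [^] m) ` Vy \<and> p \<notin> \<phi> (t [^] m) ` Vz"
    and yz: "\<And>m m'. m < M \<Longrightarrow> m' < M \<Longrightarrow> \<phi> (t [^] m) ` Vy \<inter> \<phi> (t [^] m') ` Vz = {}"
    and yy: "\<And>m m'. m < M \<Longrightarrow> m' < M \<Longrightarrow> m \<noteq> m' \<Longrightarrow> \<phi> (t [^] m) ` Vy \<inter> \<phi> (t [^] m') ` Vy = {}"
    and zz: "\<And>m m'. m < M \<Longrightarrow> m' < M \<Longrightarrow> m \<noteq> m' \<Longrightarrow> \<phi> (t [^] m) ` Vz \<inter> \<phi> (t [^] (m' :: nat)) ` Vz = {}"
    by (rule far_element[OF S, where M = M]) blast
  show thesis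
  proof (rule that[OF t(1) g], rule notI)
    fix c :: "nat \<Rightarrow> 'a" and j :: nat
    assume c: "\<And>m. c m = g \<or> (\<exists>s\<in>S. c m = g \<otimes> s \<otimes> g)" and j: "0 < j"
      and mem: "t [^] j \<in> generate G ((\<lambda>m. t [^] m \<otimes> c m \<otimes> inv (t [^] m)) ` {..<M})"
    have cc: "c m \<in> carrier G" for m using c[of m] g S by auto
    define u where "u m = t [^] m \<otimes> c m \<otimes> inv (t [^] m)" for m
    have uc: "u m \<in> carrier G" for m using cc t by (simp add: u_def)
    \<comment> \<open>The letter \<open>(m, True)\<close> stands for \<open>u m\<close> and
      \<open>(m, False)\<close> for its inverse; flipping the Boolean is formal inversion.\<close>
    define w where "w l = (if snd l then u (fst l) else inv (u (fst l)))" for l :: "nat \<times> bool"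
    define D where "D l = \<phi> (t [^] fst l) ` (if snd l then Vy else Vz)" for l :: "nat \<times> bool"
    define L where "L = {..<M} \<times> (UNIV :: bool set)"
    have act_u: "\<phi> (u m) (\<phi> (t [^] m) x) = \<phi> (t [^] m) (\<phi> (c m) x)" if "x \<in> topspace T" for x m
      using that t cc by (simp add: u_def composition_rule)
    have act_inv_u: "\<phi> (inv (u m)) (\<phi> (t [^] m) x) = \<phi> (t [^] m) (\<phi> (inv (c m)) x)" if "x \<in> topspace T" for x m
    proof -
      have "inv (u m) = t [^] m \<otimes> inv (c m) \<otimes> inv (t [^] m)"
        using t cc by (simp add: u_def inv_mult_group m_assoc)
      then show ?thesis using that t cc by (simp add: composition_rule)
    qed
    have "t [^] j \<noteq> \<one>" using t j pow_eq_id[of t j] by simp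
    moreover have "u ` {..<M} \<subseteq> w ` L" by (force simp: w_def L_def)
    then have "t [^] j \<in> generate G (w ` L)"
      using mem mono_generate unfolding u_def by blast
    ultimately have "\<exists>l\<in>L. \<phi> (t [^] j) p \<in> D l"
    proof (intro ping_pong[where \<iota> = "\<lambda>l. (fst l, \<not> snd l)" and D = D])
      show "w l \<in> carrier G" for l using uc by (simp add: w_def)
      show "w (fst l, \<not> snd l) = inv (w l)" for l using uc by (simp add: w_def)
      show "D l \<subseteq> topspace T" for l using t V by (auto simp: D_def)
      show "D l \<inter> D l' = {}" if "l \<in> L" "l' \<in> L" "l \<noteq> l'" for l l'
        using that yz[of "fst l" "fst l'"] yz[of "fst l'" "fst l"] yy[of "fst l" "fst l'"] zz[of "fst l" "fst l'"]
        by (cases l; cases l'; cases "snd l"; cases "snd l'") (auto simp: L_def D_def Int_commute)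
      show "\<phi> (w l) x \<in> D l" if l: "l \<in> L" and x: "x \<in> topspace T" "x \<notin> D (fst l, \<not> snd l)" for l x
      proof -
        obtain m b where mb: "l = (m, b)" by (cases l)
        define x' where "x' = \<phi> (inv (t [^] m)) x"
        have x': "x' \<in> topspace T" "x = \<phi> (t [^] m) x'" using t x by (auto simp: x'_def)
        show ?thesis
        proof (cases b)
          case True
          then have "x' \<notin> Vz" using x(2) x' mb by (auto simp: D_def)
          then have "\<phi> (c m) x' \<in> Vy" using maps[OF c x'(1)] by blast
          then show ?thesis using True mb act_u[OF x'(1), of m] x'(2) by (auto simp: D_def w_def)
        next
          case False
          then have "x' \<notin> Vy" using x(2) x' mb by (auto simp: D_def)
          \<comment> \<open>By contraposition: were this point outside \<open>Vz\<close>, applying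
            \<open>c m\<close> would put \<open>x'\<close> in \<open>Vy\<close>.\<close>
          then have "\<phi> (inv (c m)) x' \<in> Vz"
            using maps[OF c, of "\<phi> (inv (c m)) x'" m] cc x'(1) by auto
          then show ?thesis using False mb act_inv_u[OF x'(1), of m] x'(2) by (auto simp: D_def w_def)
        qed
      qed
      show "p \<in> topspace T" by fact
      show "p \<notin> D l" if "l \<in> L" for l using pV[of "fst l"] that by (auto simp: D_def L_def)
    qed (auto simp: L_def)
    moreover have "\<phi> (t [^] j) p = p" using act_power_dvd[of t p 1 j] t p by simp
    ultimately show False using pV by (auto simp: D_def L_def split: if_splits)
  qed
qed

end


section \<open>Generating sets with small Kazhdan constant\<close>

text \<open>The cosets of \<open>inv (t [^] k)\<close> for \<open>k < N\<close> form the almost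
  invariant set: generators other than \<open>t\<close> fix each of them, and \<open>t\<close>
  shifts them along a line. Distinctness of the cosets of powers of \<open>t\<close> makes the
  orbits infinite.\<close>

lemma (in group) kazhdan_const_le_coset_walk:
  fixes N :: nat
  assumes H: "subgroup H G" and ctbl: "countable (carrier G)"
    and S: "finite S" "S \<subseteq> carrier G" "t \<in> S"
    and t: "\<And>j. 0 < j \<Longrightarrow> t [^] (j::nat) \<notin> H"
    and N: "0 < N"
    and conj: "\<And>s k. s \<in> S \<Longrightarrow> s \<noteq> t \<Longrightarrow> k < N \<Longrightarrow> t [^] k \<otimes> s \<otimes> inv (t [^] k) \<in> H"
  shows "kazhdan_const TYPE('i::infinite \<Rightarrow> complex) G S \<le> ennreal (sqrt (2 / real N))"
proof -
  interpret H: subgroup H G by fact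
  have tc: "t \<in> carrier G" using S by blast
  define B where "B = (\<lambda>x. x <# H) ` carrier G"
  have "countable B" using ctbl by (simp add: B_def)
  then obtain e :: "'a set \<Rightarrow> 'i" where e: "inj_on e B" using countable_imp_inj_on_infinite by blast
  define c where "c x = e (x <# H)" for x
  define A where "A = c ` carrier G"
  \<comment> \<open>Translation of left cosets, transported to their labels in \<open>'i\<close>;
    \<open>inv_into\<close> decodes a label.\<close>
  define \<psi> where "\<psi> g = (\<lambda>i\<in>A. e (g <# inv_into B e i))" for g
  have c_eq: "c x = c y \<longleftrightarrow> inv x \<otimes> y \<in> H" if "x \<in> carrier G" "y \<in> carrier G" for x y
    using that inj_on_eq_iff[OF e, of "x <# H" "y <# H"] lcos_eq_iff[OF H that]
    by (simp add: c_def B_def)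
  have \<psi>_c: "\<psi> g (c x) = c (g \<otimes> x)" if "g \<in> carrier G" "x \<in> carrier G" for g x
  proof -
    have "inv_into B e (c x) = x <# H"
      using that e unfolding c_def by (intro inv_into_f_f) (auto simp: B_def)
    then show ?thesis using that lcos_m_assoc[OF H.subset] by (simp add: \<psi>_def A_def c_def)
  qed
  interpret \<psi>: group_action G A \<psi>
  proof (rule group_actionI)
    show "\<psi> g \<in> extensional A" for g by (simp add: \<psi>_def)
    show "\<psi> g x \<in> A" if "g \<in> carrier G" "x \<in> A" for g x
      using that \<psi>_c by (auto simp: A_def)
    show "\<psi> \<one> x = x" if "x \<in> A" for x using that \<psi>_c by (auto simp: A_def)
    show "\<psi> (g \<otimes> h) x = \<psi> g (\<psi> h x)" if "g \<in> carrier G" "h \<in> carrier G" "x \<in> A" for g h x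
      using that \<psi>_c by (auto simp: A_def m_assoc)
  qed (rule is_group)
  have tpow: "t [^] i \<otimes> inv (t [^] j) = t [^] (i - j)" if "j \<le> i" for i j :: nat
  proof -
    have "t [^] i = t [^] (i - j) \<otimes> t [^] j" using that tc by (simp add: nat_pow_mult)
    then show ?thesis using tc by (simp add: m_assoc)
  qed
  have tpow': "inv (t [^] i) \<otimes> t [^] j = t [^] (j - i)" if "i \<le> j" for i j :: nat
  proof -
    have "t [^] j = t [^] i \<otimes> t [^] (j - i)" using that tc by (simp add: nat_pow_mult)
    then show ?thesis using tc by (simp flip: m_assoc)
  qed
  have inj_t: "inj (\<lambda>j::nat. c (t [^] j))"
  proof (rule linorder_injI)
    fix i j :: nat assume "i < j"
    then show "c (t [^] i) \<noteq> c (t [^] j)" using c_eq tpow'[of i j] t tc by simp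
  qed
  have orb: "infinite (orbit G \<psi> i)" if "i \<in> A" for i
  proof -
    obtain x where x: "x \<in> carrier G" "i = c x" using \<open>i \<in> A\<close> by (auto simp: A_def)
    have "c y \<in> orbit G \<psi> i" if y: "y \<in> carrier G" for y
    proof -
      have "c y = \<psi> (y \<otimes> inv x) i" using x y \<psi>_c by (simp add: m_assoc)
      then show ?thesis using x y by (auto simp: orbit_def)
    qed
    then have "range (\<lambda>j::nat. c (t [^] j)) \<subseteq> orbit G \<psi> i" using tc by auto
    then show ?thesis using inj_t finite_subset range_inj_infinite by blast
  qed
  define v where "v k = c (inv (t [^] k))" for k :: nat
  define F where "F = v ` {..<N}"
  have v_ne: "v j \<noteq> v i" if "i < j" for i j
    using that c_eq tpow[of i j] t tc by (simp add: v_def)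
  then have "inj v" by (metis injI linorder_neqE_nat)
  then have cF: "card F = N" by (simp add: F_def card_image inj_on_subset)
  have \<psi>_v: "\<psi> s (v k) = c (s \<otimes> inv (t [^] k))" if "s \<in> S" for s k
    using that S tc by (auto simp: v_def \<psi>_c)
  have almost: "card (sym_diff (\<psi> s ` F) F) \<le> 2" if s: "s \<in> S" for s
  proof (cases "s = t")
    case False
    have sc: "s \<in> carrier G" using s S by blast
    have "\<psi> s (v k) = v k" if "k < N" for k
    proof -
      \<comment> \<open>Fixing the coset of \<open>inv (t [^] k)\<close> is exactly the conjugation
        hypothesis on \<open>s\<close>.\<close>
      have "v k = c (s \<otimes> inv (t [^] k))"
        unfolding v_def using conj[OF s False that] sc tc by (subst c_eq) (auto simp: m_assoc)
      then show ?thesis using \<psi>_v[OF s, of k] by metis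
    qed
    then have "\<psi> s ` F = F" by (force simp: F_def)
    then show ?thesis by simp
  next
    case True
    have shift: "\<psi> t (v (Suc k)) = v k" for k
    proof -
      have "t \<otimes> inv (t [^] Suc k) = inv (t [^] k)"
        using tc by (simp add: inv_mult_group flip: m_assoc)
      then show ?thesis using \<psi>_v[OF S(3), of "Suc k"] unfolding v_def by metis
    qed
    have "\<psi> t (v k) \<in> insert (\<psi> t (v 0)) F" if "k < N" for k
      using that shift by (cases k) (auto simp: F_def)
    moreover have "v k \<in> insert (v (N - 1)) (\<psi> t ` F)" if "k < N" for k
    proof (cases "k = N - 1")
      case False
      then have "Suc k < N" using that by simp
      then have "\<psi> t (v (Suc k)) \<in> \<psi> t ` F" by (simp add: F_def)
      then show ?thesis by (simp add: shift)
    qed simp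
    \<comment> \<open>The shift can add only the translate of \<open>v 0\<close> and lose only
      \<open>v (N - 1)\<close>; hence the constant 2 in the bound.\<close>
    ultimately have "sym_diff (\<psi> t ` F) F \<subseteq> {\<psi> t (v 0), v (N - 1)}" by (auto simp: F_def)
    then have "card (sym_diff (\<psi> t ` F) F) \<le> card {\<psi> t (v 0), v (N - 1)}" by (intro card_mono) auto
    also have "\<dots> \<le> 2" by (simp add: card_insert_if)
    finally show ?thesis using True by simp
  qed
  have "F \<subseteq> A" using tc by (auto simp: F_def v_def A_def)
  moreover have "finite F" "F \<noteq> {}" using N by (auto simp: F_def)
  ultimately show ?thesis
    using \<psi>.kazhdan_const_le_Folner[of F S 2, OF orb] S almost cF by auto
qed

text \<open>The \<open>d + 1\<close> elements \<open>b i\<close> are conjugated by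
  \<open>Suc d\<close> disjoint blocks of \<open>N\<close> consecutive powers of \<open>t\<close>.
  With \<open>t\<close> itself, the first conjugate of each block supplies the at most
  \<open>d + 2\<close> generators.\<close>

lemma (in convergence_group) kazhdan_const_le_bound:
  assumes S0: "finite S0" "generating_set G S0" and N: "0 < N"
  shows "kazhdan_const_le TYPE('i::infinite \<Rightarrow> complex) G (card S0 + 2) \<le> ennreal (sqrt (2 / real N))"
proof -
  define d where "d = card S0"
  obtain \<sigma> where \<sigma>: "bij_betw \<sigma> {..<d} S0"
    using ex_bij_betw_nat_finite[OF S0(1)] by (auto simp: d_def lessThan_atLeast0)
  have S0c: "S0 \<subseteq> carrier G" "generate G S0 = carrier G" using S0(2) by (auto simp: generating_set_def)
  obtain t g where t: "t \<in> carrier G" and g: "g \<in> carrier G"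
    and avoid: "\<And>c j. (\<And>m::nat. c m = g \<or> (\<exists>s\<in>S0. c m = g \<otimes> s \<otimes> g)) \<Longrightarrow> 0 < j \<Longrightarrow>
       t [^] (j::nat) \<notin> generate G ((\<lambda>m. t [^] m \<otimes> c m \<otimes> inv (t [^] m)) ` {..<Suc d * N})"
    using conjugates_avoid_powers[OF S0(1) S0c(1), where M = "Suc d * N"] by blast
  \<comment> \<open>Index \<open>d\<close> is reserved for \<open>g\<close> itself, so that each
    generator \<open>\<sigma> i\<close> can be recovered from
    \<open>g \<otimes> \<sigma> i \<otimes> g\<close>.\<close>
  define b where "b i = (if i < d then g \<otimes> \<sigma> i \<otimes> g else g)" for i
  have \<sigma>c: "\<sigma> i \<in> S0" "\<sigma> i \<in> carrier G" if "i < d" for i using \<sigma> that S0c by (auto simp: bij_betw_def)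
  have b_or: "b i = g \<or> (\<exists>s\<in>S0. b i = g \<otimes> s \<otimes> g)" for i using \<sigma>c by (auto simp: b_def)
  have bc: "b i \<in> carrier G" for i using \<sigma>c g by (simp add: b_def)
  \<comment> \<open>Writing \<open>m = i * N + k\<close> with \<open>k < N\<close>, the quotient
    \<open>m div N\<close> selects the block and thus \<open>b i\<close>.\<close>
  define u where "u m = t [^] m \<otimes> b (m div N) \<otimes> inv (t [^] m)" for m :: nat
  have uc: "u m \<in> carrier G" for m using t bc by (simp add: u_def)
  define H where "H = generate G (u ` {..<Suc d * N})"
  have H: "subgroup H G" unfolding H_def using uc by (intro generate_is_subgroup) auto
  have tH: "t [^] j \<notin> H" if "0 < j" for j :: nat
    unfolding H_def u_def using avoid[of "\<lambda>m. b (m div N)"] b_or that by blast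
  define h where "h i = u (i * N)" for i
  define S where "S = insert t (h ` {..d})"
  have Sc: "S \<subseteq> carrier G" using t uc by (auto simp: S_def h_def)
  have "card S \<le> Suc (card (h ` {..d}))" by (simp add: S_def card_insert_if)
  also have "\<dots> \<le> card S0 + 2" using card_image_le[of "{..d}" h] by (simp add: d_def)
  finally have cS: "card S \<le> card S0 + 2" .
  have "generate G S = carrier G"
  proof
    show "generate G S \<subseteq> carrier G" using generate_incl[OF Sc] .
    interpret K: subgroup "generate G S" G using generate_is_subgroup[OF Sc] .
    have tK: "t [^] (m::nat) \<in> generate G S" for m
      using K.m_closed K.one_closed generate.incl[of t S G] by (induction m) (auto simp: S_def)
    have bK: "b i \<in> generate G S" if "i \<le> d" for i
    proof -
      have "h i \<in> generate G S" using that by (intro generate.incl) (auto simp: S_def)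
      \<comment> \<open>Undoing the conjugation by \<open>t [^] (i * N)\<close> returns
        \<open>b i\<close>.\<close>
      then have "inv (t [^] (i * N)) \<otimes> h i \<otimes> t [^] (i * N) \<in> generate G S" using tK by simp
      moreover have "h i = t [^] (i * N) \<otimes> b i \<otimes> inv (t [^] (i * N))" using N by (simp add: h_def u_def)
      moreover have "inv x \<otimes> (x \<otimes> y \<otimes> inv x) \<otimes> x = y" if "x \<in> carrier G" "y \<in> carrier G" for x y
        using that by (simp add: m_assoc) (simp flip: m_assoc)
      ultimately show ?thesis using t bc by simp
    qed
    have gK: "g \<in> generate G S" using bK[of d] by (simp add: b_def)
    have "S0 \<subseteq> generate G S"
    proof
      fix s assume "s \<in> S0"
      then obtain i where i: "i < d" "s = \<sigma> i" using \<sigma> by (auto simp: bij_betw_def)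
      then have "inv g \<otimes> b i \<otimes> inv g \<in> generate G S" using bK[of i] gK by simp
      moreover have "inv g \<otimes> (g \<otimes> s \<otimes> g) \<otimes> inv g = s"
        using g \<sigma>c i by (simp add: m_assoc) (simp flip: m_assoc)
      ultimately show "s \<in> generate G S" using i by (simp add: b_def)
    qed
    then show "carrier G \<subseteq> generate G S"
      using generate_subgroup_incl[OF _ K.subgroup_axioms, of S0] S0c by simp
  qed
  then have gen: "generating_set G S" using Sc by (simp add: generating_set_def)
  have conj: "t [^] k \<otimes> s \<otimes> inv (t [^] k) \<in> H" if s: "s \<in> S" "s \<noteq> t" and k: "k < N" for s k
  proof -
    obtain i where i: "i \<le> d" "s = h i" using s by (auto simp: S_def)
    have div: "(k + i * N) div N = i" using k by simp
    have "t [^] k \<otimes> (t [^] (i * N) \<otimes> b i \<otimes> inv (t [^] (i * N))) \<otimes> inv (t [^] k)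
        = (t [^] k \<otimes> t [^] (i * N)) \<otimes> b i \<otimes> inv (t [^] k \<otimes> t [^] (i * N))"
      using t bc by (simp add: inv_mult_group m_assoc)
    \<comment> \<open>Conjugating the first element of block \<open>i\<close> by
      \<open>t [^] k\<close> only moves it to position \<open>k\<close> of the same block, which is
      a generator of \<open>H\<close>.\<close>
    then have eq: "t [^] k \<otimes> s \<otimes> inv (t [^] k) = u (k + i * N)"
      using i t N div by (simp add: h_def u_def nat_pow_mult)
    have "k + i * N < Suc i * N" using k by simp
    also have "\<dots> \<le> Suc d * N" using i by (intro mult_le_mono1) simp
    finally show ?thesis unfolding eq H_def by (intro generate.incl) auto
  qed
  have ctbl: "countable (carrier G)"
    using countable_generate[OF countable_finite[OF S0(1)] S0c(1)] S0c(2) by simp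
  have "kazhdan_const_le TYPE('i \<Rightarrow> complex) G (card S0 + 2) \<le> kazhdan_const TYPE('i \<Rightarrow> complex) G S"
    unfolding kazhdan_const_le_def using gen cS by (intro INF_lower) (auto simp: S_def)
  also have "\<dots> \<le> ennreal (sqrt (2 / real N))"
    using Sc tH N conj by (intro kazhdan_const_le_coset_walk[OF H ctbl]) (auto simp: S_def)
  finally show ?thesis .
qed

theorem theorem1p2:
  fixes G :: "('g, 'b) monoid_scheme"
    and T :: "'x topology"
    and \<phi> :: "'g \<Rightarrow> 'x \<Rightarrow> 'x"
  assumes "group G"
    and "finitely_generated G"
    and "compact_space T"
    and "metrizable_space T"
    and "convergence_action G T \<phi>"
    and "non_elementary G T \<phi>"
  shows "kazhdan_const_le TYPE('i::infinite \<Rightarrow> complex) G (min_generators G + 2) = 0"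
proof -
  interpret convergence_group G T \<phi>
    using assms by (simp add: convergence_group_def convergence_group_axioms_def metrizable_imp_Hausdorff_space)
  have "\<exists>S. finite S \<and> generating_set G S \<and> card S = min_generators G"
    unfolding min_generators_def
    by (rule LeastI_ex) (use assms(2) in \<open>auto simp: finitely_generated_def\<close>)
  then obtain S0 where S0: "finite S0" "generating_set G S0" "card S0 = min_generators G" by blast
  let ?\<kappa> = "kazhdan_const_le TYPE('i \<Rightarrow> complex) G (min_generators G + 2)"
  \<comment> \<open>One generating set for each \<open>N\<close>; \<open>Suc N\<close> supplies the
    positive block length, and the bounds tend to 0.\<close>
  have "?\<kappa> \<le> ennreal (sqrt (2 / real (Suc N)))" for N
    using kazhdan_const_le_bound[OF S0(1,2), of "Suc N"] S0(3) by simp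
  moreover have "(\<lambda>N. sqrt (2 / real (Suc N))) \<longlonglongrightarrow> sqrt 0"
    by (intro tendsto_real_sqrt LIMSEQ_Suc[OF lim_const_over_n])
  then have "(\<lambda>N. ennreal (sqrt (2 / real (Suc N)))) \<longlonglongrightarrow> ennreal (sqrt 0)"
    by (rule tendsto_ennrealI)
  ultimately have "?\<kappa> \<le> ennreal (sqrt 0)"
    by (intro LIMSEQ_le_const) auto
  then show ?thesis by simp
qed

end
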